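(* Let $\mu$ be a fixed measure on $\mathbb{R}$, let $\Theta$ be an open subset of $\mathbb{R}$ such that $\exp(\theta x-\beta(\theta))$ is a probability density with respect to $\mu$ for each $\theta\in\Theta$, let $\Theta_0$ be a fixed compact subset of $\Theta$, and let $\delta>0$ be fixed. For each $n$ and each $m=(m_1,\ldots,m_n)\in\Theta^n$ let $X=(X_1,\ldots,X_n)^{\mathrm T}$ have, under $m$, independent entries with $X_i$ having density $\exp(m_i x_i-\beta(m_i))$ with respect to $\mu$; let $\mathrm{E}_m$ denote expectation under $m$. Let $\mathcal{T}=\mathcal{T}_n$ be the family of all test functions $T(X)$ invariant under permutations of the entries of $X$. Then, as $n\to\infty$, $$\sup\{|\mathrm{E}_m(T)-\mathrm{E}_{\overline m}(T)| : T\in\mathcal{T},\ \|m-\overline m\|\le\delta,\ m_i\in\Theta_0 \text{ for } i=1,\ldots,n\}\to 0 .$$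
   Context: $\overline m=\sum_{i=1}^n m_i/n$; the symbol $\overline m$ is also used for the vector of length $n$ all of whose entries equal $\overline m$, so $\|m-\overline m\|^2=\sum_i(m_i-\overline m)^2$ and $\mathrm{E}_{\overline m}$ is expectation when $X_1,\ldots,X_n$ are i.i.d. with density $\exp(\overline m x-\beta(\overline m))$. (If $\overline m\notin\Theta$, the same formula, with $\beta(\theta)=\log\int e^{\theta x}\mu(dx)$, still defines a density, because the set of $\theta$ where this integral is finite is convex.) A test function is a measurable function of the data with values in $[0,1]$. The null hypothesis being tested is $m_1=\cdots=m_n$. *)

theory Defs
  imports "HOL-Probability.Probability" "HOL-Combinatorics.Permutations"
begin

text \<open>
  Meaningful only where \<open>\<lambda>x. exp (\<theta> * x)\<close> is integrable with positive integral. If this fails, the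
  Bochner integral and hence the value below are 0, and \<open>exp_family\<close> is not a probability measure.
\<close>

definition log_partition :: "real measure \<Rightarrow> real \<Rightarrow> real" where
  "log_partition \<mu> \<theta> = ln (LINT x|\<mu>. exp (\<theta> * x))"

definition exp_family :: "real measure \<Rightarrow> real \<Rightarrow> real measure" where
  "exp_family \<mu> \<theta> = density \<mu> (\<lambda>x. ennreal (exp (\<theta> * x - log_partition \<mu> \<theta>)))"

text \<open>
  Vectors of length \<open>n\<close> are functions on \<open>{..<n}\<close>. Parameter vectors \<open>m\<close> may take any values outside
  \<open>{..<n}\<close>, which are never used; data vectors are the extensional functions forming the space of
  the product measure.
\<close>

definition joint_law :: "real measure \<Rightarrow> nat \<Rightarrow> (nat \<Rightarrow> real) \<Rightarrow> (nat \<Rightarrow> real) measure" where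
  "joint_law \<mu> n m = (\<Pi>\<^sub>M i\<in>{..<n}. exp_family \<mu> (m i))"

definition vec_mean :: "nat \<Rightarrow> (nat \<Rightarrow> real) \<Rightarrow> real" where
  "vec_mean n m = (\<Sum>i<n. m i) / real n"

definition test_functions :: "nat \<Rightarrow> ((nat \<Rightarrow> real) \<Rightarrow> real) set" where
  "test_functions n =
    {T \<in> borel_measurable (\<Pi>\<^sub>M i\<in>{..<n}. borel).
      \<forall>x\<in>space (\<Pi>\<^sub>M i\<in>{..<n}. (borel :: real measure)). T x \<in> {0..1}}"

text \<open>
  Since \<open>p\<close> fixes every index outside \<open>{..<n}\<close>, \<open>x \<circ> p\<close> is again extensional.
\<close>

definition invariant_test_functions :: "nat \<Rightarrow> ((nat \<Rightarrow> real) \<Rightarrow> real) set" where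
  "invariant_test_functions n =
    {T \<in> test_functions n.
      \<forall>p. p permutes {..<n} \<longrightarrow>
        (\<forall>x\<in>space (\<Pi>\<^sub>M i\<in>{..<n}. (borel :: real measure)). T (x \<circ> p) = T x)}"

end

theory Submission imports Defs begin

text \<open>
  Write \<open>Q\<close> for the law with parameter \<open>\<theta>\<close> equal to the mean of the \<open>m i\<close>, \<open>f i\<close> for the density of the
  \<open>i\<close>-th coordinate with respect to \<open>Q\<close>, and \<open>h i = f i - 1\<close>. An invariant test cannot distinguish the
  joint law from the mixture of all its coordinate permutations, so it is enough to show that this
  mixture is close in total variation to the product of copies of \<open>Q\<close>. Its likelihood ratio \<open>Lbar\<close> is
  the average over permutations \<open>p\<close> of the products of \<open>f (p i) (x i)\<close>, and the total variation
  distance is controlled by the chi-square divergence, the second moment of \<open>Lbar\<close> minus 1.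

  That second moment is an average over permutations \<open>p\<close> of the products of \<open>1 + A i (p i)\<close>, where
  \<open>A i k\<close> is the \<open>L\<^sup>2\<close> inner product of \<open>h i\<close> and \<open>h k\<close>. Since \<open>1 + t \<le> exp t\<close>, each product is at
  most \<open>exp (S p)\<close> with \<open>S p\<close> the sum of the \<open>A i (p i)\<close>. If the squared norms of the \<open>h i\<close> have
  bounded sum, then \<open>S\<close> is bounded, and \<open>exp (S p) - 1\<close> is at most a constant times the absolute value
  of \<open>S p\<close>. For a random permutation the second moment of \<open>S\<close> is of order \<open>1 / n\<close> as soon as the sum
  of all entries of \<open>A\<close>, which is the squared norm of the sum of the \<open>h i\<close>, is bounded as well. This
  gives the general comparison \<open>permutation_mixture_close_to_iid\<close>.

  Two things remain for an exponential family. First, for small shifts \<open>d = m i - \<theta>\<close> the function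
  \<open>h i x\<close> is \<open>d * (x - E x)\<close> up to an error of order \<open>d\<^sup>2\<close> (\<open>exponential_tilt_expansion\<close>).
  The shifts sum to zero and their squares sum to at most \<open>\<delta>\<^sup>2\<close>, so both sums above are
  bounded. Secondly, a shift that is not small may have a density that is not even square integrable
  with respect to \<open>Q\<close>. At most \<open>\<delta>\<^sup>2 / \<epsilon>\<^sup>2\<close> coordinates have a shift beyond \<open>\<epsilon>\<close>. Truncating
  their densities at a fixed large radius makes them bounded; this costs little in total variation,
  and since the number of such coordinates is bounded they contribute only bounded terms to the two
  sums (\<open>exponential_tilts_close_to_iid\<close>). Besides \<open>\<delta>\<close> and the diameter of \<open>\<Theta>\<^sub>0\<close>, the constants
  depend only on a common bound for an exponential moment of the laws involved, which exists because
  \<open>\<Theta>\<^sub>0\<close> is a compact subset of the open set \<open>\<Theta>\<close> (\<open>exp_family_on_interval\<close>).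
\<close>

section \<open>Random permutations of a matrix\<close>

text \<open>
  A uniformly random permutation moves a given point to a uniformly distributed one: by symmetry
  the left-hand sum is the same for every \<open>i\<close>, and the total over \<open>i\<close> is computed permutation by
  permutation.
\<close>

lemma sum_permutations_one_point:
  fixes \<phi> :: "'a \<Rightarrow> real"
  assumes "finite I" "i \<in> I"
  shows "real (card I) * (\<Sum>p | p permutes I. \<phi> (p i)) = fact (card I) * (\<Sum>k\<in>I. \<phi> k)"
proof -
  have *: "(\<Sum>p | p permutes I. \<phi> (p j)) = (\<Sum>p | p permutes I. \<phi> (p i))" if "j \<in> I" for j
    using sum_permutations_compose_right[OF permutes_swap_id[OF assms(2) that], of "\<lambda>p. \<phi> (p j)", symmetric]
    by simp
  have "real (card I) * (\<Sum>p | p permutes I. \<phi> (p i)) = (\<Sum>j\<in>I. \<Sum>p | p permutes I. \<phi> (p j))"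
    by (simp add: *)
  also have "\<dots> = (\<Sum>p | p permutes I. \<Sum>j\<in>I. \<phi> (p j))"
    by (rule sum.swap)
  also have "\<dots> = (\<Sum>p | p permutes I. \<Sum>k\<in>I. \<phi> k)"
    by (intro sum.cong refl sum.reindex_bij_betw permutes_imp_bij) simp
  finally show ?thesis
    using assms by (simp add: card_permutations)
qed

lemma ex_permutation_two_points:
  assumes "i \<in> I" "j \<in> I" "i \<noteq> j" "i' \<in> I" "j' \<in> I" "i' \<noteq> j'"
  shows "\<exists>q. q permutes I \<and> q i = i' \<and> q j = j'"
proof -
  define x where "x = Transposition.transpose i i' j"
  have "x \<in> I" "x \<noteq> i'"
    using assms by (auto simp: x_def Transposition.transpose_def)
  let ?q = "Transposition.transpose x j' \<circ> Transposition.transpose i i'"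
  have "?q permutes I"
    using assms \<open>x \<in> I\<close> by (intro permutes_compose permutes_swap_id)
  moreover have "?q i = i'" "?q j = j'"
    using assms(6) \<open>x \<noteq> i'\<close> by (simp_all add: x_def[symmetric])
  ultimately show ?thesis by blast
qed

text \<open>
  The same symmetry argument for pairs: two distinct points are moved to a uniformly distributed
  pair of distinct points.
\<close>

lemma sum_permutations_two_points:
  fixes \<phi> :: "'a \<Rightarrow> 'a \<Rightarrow> real"
  assumes fin: "finite I" and ij: "i \<in> I" "j \<in> I" "i \<noteq> j"
  shows "real (card I * (card I - 1)) * (\<Sum>p | p permutes I. \<phi> (p i) (p j)) =
    fact (card I) * (\<Sum>k\<in>I. \<Sum>l\<in>I - {k}. \<phi> k l)"
proof -
  have *: "(\<Sum>p | p permutes I. \<phi> (p k) (p l)) = (\<Sum>p | p permutes I. \<phi> (p i) (p j))"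
    if kl: "k \<in> I" "l \<in> I - {k}" for k l
  proof -
    obtain q where q: "q permutes I" "q i = k" "q j = l"
      using ex_permutation_two_points[of i I j k l] ij kl by blast
    show ?thesis
      using sum_permutations_compose_right[OF q(1), of "\<lambda>p. \<phi> (p i) (p j)", symmetric] q by simp
  qed
  have "real (card I * (card I - 1)) * (\<Sum>p | p permutes I. \<phi> (p i) (p j)) =
      (\<Sum>k\<in>I. \<Sum>l\<in>I - {k}. \<Sum>p | p permutes I. \<phi> (p k) (p l))"
  proof -
    have "(\<Sum>k\<in>I. \<Sum>l\<in>I - {k}. \<Sum>p | p permutes I. \<phi> (p k) (p l)) =
        (\<Sum>k\<in>I. \<Sum>l\<in>I - {k}. \<Sum>p | p permutes I. \<phi> (p i) (p j))"
      by (intro sum.cong refl *)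
    then show ?thesis using fin by simp
  qed
  also have "\<dots> = (\<Sum>k\<in>I. \<Sum>p | p permutes I. \<Sum>l\<in>I - {k}. \<phi> (p k) (p l))"
    by (intro sum.cong refl sum.swap)
  also have "\<dots> = (\<Sum>p | p permutes I. \<Sum>k\<in>I. \<Sum>l\<in>I - {k}. \<phi> (p k) (p l))"
    by (rule sum.swap)
  also have "\<dots> = (\<Sum>p | p permutes I. \<Sum>k\<in>I. \<Sum>l\<in>I - {k}. \<phi> k l)"
  proof (rule sum.cong[OF refl])
    fix p assume "p \<in> {p. p permutes I}"
    then have p: "p permutes I" by simp
    have "bij_betw p (I - {k}) (I - {p k})" if "k \<in> I" for k
      using bij_betw_DiffI[OF permutes_imp_bij[OF p], of "{k}" "{p k}"] that
      by (auto simp: bij_betw_def permutes_in_image[OF p])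
    then have "(\<Sum>k\<in>I. \<Sum>l\<in>I - {k}. \<phi> (p k) (p l)) = (\<Sum>k\<in>I. \<Sum>l\<in>I - {p k}. \<phi> (p k) l)"
      by (intro sum.cong refl sum.reindex_bij_betw)
    also have "\<dots> = (\<Sum>k\<in>I. \<Sum>l\<in>I - {k}. \<phi> k l)"
      by (rule sum.reindex_bij_betw[OF permutes_imp_bij[OF p], of "\<lambda>k. \<Sum>l\<in>I - {k}. \<phi> k l"])
    finally show "(\<Sum>k\<in>I. \<Sum>l\<in>I - {k}. \<phi> (p k) (p l)) = (\<Sum>k\<in>I. \<Sum>l\<in>I - {k}. \<phi> k l)" .
  qed
  finally show ?thesis
    using fin by (simp add: card_permutations)
qed

lemma sum_off_diagonal:
  fixes \<phi> :: "'a \<Rightarrow> 'a \<Rightarrow> real"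
  assumes "finite I"
  shows "(\<Sum>k\<in>I. \<Sum>l\<in>I - {k}. \<phi> k l) = (\<Sum>k\<in>I. \<Sum>l\<in>I. \<phi> k l) - (\<Sum>k\<in>I. \<phi> k k)"
proof -
  have "(\<Sum>k\<in>I. \<Sum>l\<in>I - {k}. \<phi> k l) = (\<Sum>k\<in>I. (\<Sum>l\<in>I. \<phi> k l) - \<phi> k k)"
    using assms by (intro sum.cong refl) (simp add: sum_diff1)
  then show ?thesis by (simp only: sum_subtractf)
qed

text \<open>
  Expanding the square gives diagonal terms, whose average is the mean of the squared entries, and
  terms for two distinct rows, in which \<open>p\<close> picks two distinct columns uniformly. By
  inclusion-exclusion the latter add up to the squared total of \<open>A\<close>, minus the squared row sums and
  the squared column sums, plus the squared entries; the row and column sums are discarded. So the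
  second moment is of order \<open>1 / card I\<close> for matrices with bounded total and bounded sum of squares.
\<close>

lemma permutation_sum_second_moment:
  fixes A :: "'a \<Rightarrow> 'a \<Rightarrow> real"
  assumes fin: "finite I" and n: "2 \<le> card I"
  shows "(\<Sum>p | p permutes I. (\<Sum>i\<in>I. A i (p i))\<^sup>2) \<le>
    fact (card I) * (((\<Sum>i\<in>I. \<Sum>k\<in>I. A i k)\<^sup>2 + 2 * (\<Sum>i\<in>I. \<Sum>k\<in>I. (A i k)\<^sup>2)) / card I)"
proof -
  let ?n = "real (card I)" and ?P = "{p. p permutes I}"
  define X where "X = (\<Sum>i\<in>I. \<Sum>k\<in>I. (A i k)\<^sup>2)"
  define Y where "Y = (\<Sum>i\<in>I. \<Sum>j\<in>I - {i}. \<Sum>k\<in>I. \<Sum>l\<in>I - {k}. A i k * A j l)"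
  have n0: "?n > 0" "?n * (?n - 1) > 0" "?n * (?n - 1) \<ge> ?n" "real (card I * (card I - 1)) = ?n * (?n - 1)"
    using n by (auto simp: of_nat_diff mult_le_cancel_left1)
  have one: "(\<Sum>p\<in>?P. (A i (p i))\<^sup>2) = fact (card I) * (\<Sum>k\<in>I. (A i k)\<^sup>2) / ?n" if "i \<in> I" for i
    using sum_permutations_one_point[OF fin that, of "\<lambda>k. (A i k)\<^sup>2"] n0 by (simp add: field_simps)
  have two: "(\<Sum>p\<in>?P. A i (p i) * A j (p j)) =
      fact (card I) * (\<Sum>k\<in>I. \<Sum>l\<in>I - {k}. A i k * A j l) / (?n * (?n - 1))"
    if "i \<in> I" "j \<in> I - {i}" for i j
  proof -
    have "i \<noteq> j" "j \<in> I" using that by auto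
    then have "?n * (?n - 1) * (\<Sum>p\<in>?P. A i (p i) * A j (p j)) =
        fact (card I) * (\<Sum>k\<in>I. \<Sum>l\<in>I - {k}. A i k * A j l)"
      using sum_permutations_two_points[OF fin \<open>i \<in> I\<close>, of j "\<lambda>k l. A i k * A j l"] unfolding n0(4) by simp
    then have "(\<Sum>p\<in>?P. A i (p i) * A j (p j)) * (?n * (?n - 1)) =
        fact (card I) * (\<Sum>k\<in>I. \<Sum>l\<in>I - {k}. A i k * A j l)"
      by (subst mult.commute)
    with n0(1,2) show ?thesis
      by (intro eq_divide_imp) auto
  qed
  have "(\<Sum>p\<in>?P. (\<Sum>i\<in>I. A i (p i))\<^sup>2) =
      (\<Sum>p\<in>?P. (\<Sum>i\<in>I. (A i (p i))\<^sup>2) + (\<Sum>i\<in>I. \<Sum>j\<in>I - {i}. A i (p i) * A j (p j)))"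
    unfolding sum_off_diagonal[OF fin] by (simp add: power2_eq_square sum_product)
  also have "\<dots> = (\<Sum>i\<in>I. \<Sum>p\<in>?P. (A i (p i))\<^sup>2) + (\<Sum>i\<in>I. \<Sum>j\<in>I - {i}. \<Sum>p\<in>?P. A i (p i) * A j (p j))"
  proof -
    have "(\<Sum>p\<in>?P. \<Sum>i\<in>I. (A i (p i))\<^sup>2) = (\<Sum>i\<in>I. \<Sum>p\<in>?P. (A i (p i))\<^sup>2)"
      by (rule sum.swap)
    moreover have "(\<Sum>p\<in>?P. \<Sum>i\<in>I. \<Sum>j\<in>I - {i}. A i (p i) * A j (p j)) =
        (\<Sum>i\<in>I. \<Sum>p\<in>?P. \<Sum>j\<in>I - {i}. A i (p i) * A j (p j))"
      by (rule sum.swap)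
    moreover have "\<dots> = (\<Sum>i\<in>I. \<Sum>j\<in>I - {i}. \<Sum>p\<in>?P. A i (p i) * A j (p j))"
      by (intro sum.cong refl sum.swap)
    ultimately show ?thesis by (simp only: sum.distrib)
  qed
  also have "\<dots> = fact (card I) * (X / ?n + Y / (?n * (?n - 1)))"
  proof -
    have "(\<Sum>i\<in>I. \<Sum>p\<in>?P. (A i (p i))\<^sup>2) = fact (card I) * X / ?n"
      by (simp add: one X_def sum_distrib_left sum_divide_distrib)
    moreover have "(\<Sum>i\<in>I. \<Sum>j\<in>I - {i}. \<Sum>p\<in>?P. A i (p i) * A j (p j)) =
        (\<Sum>i\<in>I. \<Sum>j\<in>I - {i}. fact (card I) * (\<Sum>k\<in>I. \<Sum>l\<in>I - {k}. A i k * A j l) / (?n * (?n - 1)))"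
      by (intro sum.cong refl two)
    moreover have "\<dots> = fact (card I) * Y / (?n * (?n - 1))"
      unfolding Y_def sum_distrib_left sum_divide_distrib ..
    ultimately show ?thesis by (simp add: distrib_left)
  qed
  also have "Y / (?n * (?n - 1)) \<le> ((\<Sum>i\<in>I. \<Sum>k\<in>I. A i k)\<^sup>2 + X) / ?n"
  proof -
    have inner: "(\<Sum>k\<in>I. \<Sum>l\<in>I - {k}. A i k * A j l) =
        (\<Sum>k\<in>I. A i k) * (\<Sum>l\<in>I. A j l) - (\<Sum>k\<in>I. A i k * A j k)" for i j
      by (simp add: sum_off_diagonal[OF fin] sum_product)
    have "Y = (\<Sum>i\<in>I. \<Sum>k\<in>I. A i k)\<^sup>2 - (\<Sum>i\<in>I. (\<Sum>k\<in>I. A i k)\<^sup>2)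
        - (\<Sum>i\<in>I. \<Sum>j\<in>I. \<Sum>k\<in>I. A i k * A j k) + X"
      unfolding Y_def X_def inner sum_off_diagonal[OF fin]
      by (simp add: sum_subtractf power2_eq_square sum_distrib_left[symmetric] sum_distrib_right[symmetric])
    also have "(\<Sum>i\<in>I. \<Sum>j\<in>I. \<Sum>k\<in>I. A i k * A j k) = (\<Sum>k\<in>I. (\<Sum>i\<in>I. A i k)\<^sup>2)"
    proof -
      have "(\<Sum>i\<in>I. \<Sum>j\<in>I. \<Sum>k\<in>I. A i k * A j k) = (\<Sum>i\<in>I. \<Sum>k\<in>I. \<Sum>j\<in>I. A i k * A j k)"
        by (intro sum.cong refl sum.swap)
      also have "\<dots> = (\<Sum>k\<in>I. \<Sum>i\<in>I. \<Sum>j\<in>I. A i k * A j k)"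
        by (rule sum.swap)
      finally show ?thesis by (simp add: power2_eq_square sum_product)
    qed
    finally have "Y \<le> (\<Sum>i\<in>I. \<Sum>k\<in>I. A i k)\<^sup>2 + X"
      using sum_nonneg[of I "\<lambda>i. (\<Sum>k\<in>I. A i k)\<^sup>2"] sum_nonneg[of I "\<lambda>k. (\<Sum>i\<in>I. A i k)\<^sup>2"] by simp
    moreover have "X \<ge> 0" by (auto simp: X_def intro!: sum_nonneg)
    ultimately show ?thesis
      using n0 by (intro frac_le) auto
  qed
  finally show ?thesis
    by (simp add: X_def[symmetric] algebra_simps add_divide_distrib)
qed

lemma abs_exp_minus_one_le: "\<bar>exp x - 1\<bar> \<le> \<bar>x\<bar> * exp \<bar>x\<bar>" for x :: real
proof -
  have "1 - exp (-\<bar>x\<bar>) \<le> \<bar>x\<bar>"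
    using exp_ge_add_one_self[of "-\<bar>x\<bar>"] by simp
  then have *: "exp \<bar>x\<bar> - 1 \<le> \<bar>x\<bar> * exp \<bar>x\<bar>"
    using mult_right_mono[of "1 - exp (-\<bar>x\<bar>)" "\<bar>x\<bar>" "exp \<bar>x\<bar>"]
    by (simp add: algebra_simps exp_minus)
  show ?thesis
  proof (cases "x \<ge> 0")
    case False
    then have "1 - exp x \<le> -x" using exp_ge_add_one_self[of x] by linarith
    also have "\<dots> \<le> \<bar>x\<bar> * exp \<bar>x\<bar>" using False by simp
    finally show ?thesis using False by simp
  qed (use * in simp)
qed

text \<open>
  The left-hand side is a normalised permanent of the matrix with entries \<open>1 + A i k\<close>. The bound
  \<open>u i * u k\<close> on the squared entries keeps the sums \<open>S p = (\<Sum>i\<in>I. A i (p i))\<close> in \<open>{-s..s}\<close>; there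
  \<open>exp (S p)\<close> exceeds 1 by at most \<open>exp s\<close> times the absolute value of \<open>S p\<close>, whose mean is at most
  the root of the second moment.
\<close>

lemma mean_permutation_product_le:
  fixes A :: "'a \<Rightarrow> 'a \<Rightarrow> real" and u :: "'a \<Rightarrow> real"
  assumes fin: "finite I" and n: "2 \<le> card I"
    and A: "\<And>i k. i \<in> I \<Longrightarrow> k \<in> I \<Longrightarrow> (A i k)\<^sup>2 \<le> u i * u k"
    and pos: "\<And>i k. i \<in> I \<Longrightarrow> k \<in> I \<Longrightarrow> 0 \<le> 1 + A i k"
    and u: "\<And>i. i \<in> I \<Longrightarrow> 0 \<le> u i" "(\<Sum>i\<in>I. u i) \<le> s"
    and tot: "\<bar>\<Sum>i\<in>I. \<Sum>k\<in>I. A i k\<bar> \<le> a"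
  shows "(\<Sum>p | p permutes I. \<Prod>i\<in>I. 1 + A i (p i)) / fact (card I) \<le>
    1 + exp s * sqrt ((a\<^sup>2 + 2 * s\<^sup>2) / card I)"
proof -
  let ?P = "{p. p permutes I}" and ?N = "fact (card I) :: real"
  define S where "S p = (\<Sum>i\<in>I. A i (p i))" for p
  define V where "V = (a\<^sup>2 + 2 * s\<^sup>2) / card I"
  have cardP: "real (card ?P) = ?N" using fin by (simp add: card_permutations)
  have a0: "a \<ge> 0" using tot by simp
  have S_le: "\<bar>S p\<bar> \<le> s" if p: "p permutes I" for p
  proof -
    have "\<bar>S p\<bar> \<le> (\<Sum>i\<in>I. \<bar>A i (p i)\<bar>)" by (simp add: S_def)
    also have "\<dots> \<le> (\<Sum>i\<in>I. (u i + u (p i)) / 2)"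
    proof (rule sum_mono)
      fix i assume i: "i \<in> I"
      then have pi: "p i \<in> I" using permutes_in_image[OF p] by simp
      have "\<bar>A i (p i)\<bar> \<le> sqrt (u i * u (p i))"
        using A[OF i pi] by (metis real_sqrt_abs real_sqrt_le_iff)
      also have "\<dots> \<le> (u i + u (p i)) / 2"
        using arith_geo_mean_sqrt[of "u i" "u (p i)"] u(1) i pi by simp
      finally show "\<bar>A i (p i)\<bar> \<le> (u i + u (p i)) / 2" .
    qed
    also have "\<dots> = ((\<Sum>i\<in>I. u i) + (\<Sum>i\<in>I. u (p i))) / 2"
      by (simp add: sum.distrib sum_divide_distrib[symmetric])
    also have "(\<Sum>i\<in>I. u (p i)) = (\<Sum>i\<in>I. u i)"
      by (rule sum.reindex_bij_betw[OF permutes_imp_bij[OF p]])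
    finally show ?thesis using u(2) by simp
  qed
  have "(\<Sum>i\<in>I. \<Sum>k\<in>I. (A i k)\<^sup>2) \<le> (\<Sum>i\<in>I. \<Sum>k\<in>I. u i * u k)"
    using A by (intro sum_mono) auto
  also have "\<dots> = (\<Sum>i\<in>I. u i)\<^sup>2" by (simp add: power2_eq_square sum_product)
  also have "\<dots> \<le> s\<^sup>2" using u sum_nonneg[of I u] by (intro power_mono) auto
  finally have sq: "(\<Sum>i\<in>I. \<Sum>k\<in>I. (A i k)\<^sup>2) \<le> s\<^sup>2" .
  have tot2: "(\<Sum>i\<in>I. \<Sum>k\<in>I. A i k)\<^sup>2 \<le> a\<^sup>2"
    using tot by (metis abs_le_square_iff abs_of_nonneg a0)
  have "(\<Sum>p\<in>?P. (S p)\<^sup>2) \<le>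
      ?N * (((\<Sum>i\<in>I. \<Sum>k\<in>I. A i k)\<^sup>2 + 2 * (\<Sum>i\<in>I. \<Sum>k\<in>I. (A i k)\<^sup>2)) / card I)"
    unfolding S_def by (rule permutation_sum_second_moment[OF fin n])
  also have "\<dots> \<le> ?N * V"
    unfolding V_def using sq tot2 by (intro mult_left_mono divide_right_mono) auto
  finally have S2: "(\<Sum>p\<in>?P. (S p)\<^sup>2) \<le> ?N * V" .
  have "(\<Sum>p\<in>?P. \<bar>S p\<bar>)\<^sup>2 \<le> (\<Sum>p\<in>?P. 1\<^sup>2) * (\<Sum>p\<in>?P. \<bar>S p\<bar>\<^sup>2)"
    using Cauchy_Schwarz_ineq_sum[of "\<lambda>_. 1" "\<lambda>p. \<bar>S p\<bar>" ?P] by simp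
  also have "\<dots> \<le> ?N * (?N * V)"
    using S2 cardP by (simp add: mult_left_mono)
  finally have "(\<Sum>p\<in>?P. \<bar>S p\<bar>) \<le> sqrt (?N * (?N * V))"
    by (rule real_le_rsqrt)
  also have "\<dots> = ?N * sqrt V" by (simp add: real_sqrt_mult)
  finally have S1: "(\<Sum>p\<in>?P. \<bar>S p\<bar>) \<le> ?N * sqrt V" .
  have "(\<Sum>p\<in>?P. \<Prod>i\<in>I. 1 + A i (p i)) \<le> (\<Sum>p\<in>?P. 1 + \<bar>S p\<bar> * exp s)"
  proof (rule sum_mono)
    fix p assume "p \<in> ?P"
    then have p: "p permutes I" by simp
    have "(\<Prod>i\<in>I. 1 + A i (p i)) \<le> (\<Prod>i\<in>I. exp (A i (p i)))"
      using pos permutes_in_image[OF p] by (intro prod_mono) auto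
    also have "\<dots> = exp (S p)" by (simp add: S_def exp_sum fin)
    also have "\<dots> \<le> 1 + \<bar>S p\<bar> * exp \<bar>S p\<bar>"
      using abs_exp_minus_one_le[of "S p"] by simp
    also have "\<dots> \<le> 1 + \<bar>S p\<bar> * exp s"
      using S_le[OF p] by (simp add: mult_left_mono)
    finally show "(\<Prod>i\<in>I. 1 + A i (p i)) \<le> 1 + \<bar>S p\<bar> * exp s" .
  qed
  also have "\<dots> = ?N + (\<Sum>p\<in>?P. \<bar>S p\<bar>) * exp s"
    using cardP by (simp add: sum.distrib sum_distrib_right)
  also have "\<dots> \<le> ?N + ?N * sqrt V * exp s"
    using S1 by simp
  finally show ?thesis
    by (simp add: V_def field_simps)
qed

section \<open>Product measures with product densities\<close>

lemma Cauchy_Schwarz_integral: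
  fixes f g :: "'a \<Rightarrow> real"
  assumes [measurable]: "f \<in> borel_measurable M" "g \<in> borel_measurable M"
    and f2: "integrable M (\<lambda>x. (f x)\<^sup>2)" and g2: "integrable M (\<lambda>x. (g x)\<^sup>2)"
  shows "integrable M (\<lambda>x. f x * g x)"
    and "(LINT x|M. f x * g x)\<^sup>2 \<le> (LINT x|M. (f x)\<^sup>2) * (LINT x|M. (g x)\<^sup>2)"
proof -
  have young: "\<bar>f x * g x\<bar> \<le> ((f x)\<^sup>2 + (g x)\<^sup>2) / 2" for x
    using sum_squares_bound[of "\<bar>f x\<bar>" "\<bar>g x\<bar>"] by (simp add: abs_mult)
  show fg: "integrable M (\<lambda>x. f x * g x)"
    by (rule Bochner_Integration.integrable_bound[where f = "\<lambda>x. ((f x)\<^sup>2 + (g x)\<^sup>2) / 2"])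
      (use young f2 g2 in \<open>auto intro!: AE_I2\<close>)
  define \<alpha> \<beta> \<gamma> where
    "\<alpha> = (LINT x|M. (f x)\<^sup>2)" and "\<beta> = (LINT x|M. (g x)\<^sup>2)" and "\<gamma> = (LINT x|M. f x * g x)"
  have "\<alpha> \<ge> 0" "\<beta> \<ge> 0" by (simp_all add: \<alpha>_def \<beta>_def)
  have quad: "0 \<le> s\<^sup>2 * \<alpha> - 2 * (s * t) * \<gamma> + t\<^sup>2 * \<beta>" for s t
  proof -
    have "0 \<le> (LINT x|M. (s * f x - t * g x)\<^sup>2)" by simp
    also have "\<dots> = (LINT x|M. s\<^sup>2 * (f x)\<^sup>2 - 2 * (s * t) * (f x * g x) + t\<^sup>2 * (g x)\<^sup>2)"
      by (intro Bochner_Integration.integral_cong) (auto simp: power2_eq_square algebra_simps)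
    also have "\<dots> = s\<^sup>2 * \<alpha> - 2 * (s * t) * \<gamma> + t\<^sup>2 * \<beta>"
      using f2 g2 fg by (simp add: \<alpha>_def \<beta>_def \<gamma>_def)
    finally show ?thesis .
  qed
  have "\<gamma>\<^sup>2 \<le> \<alpha> * \<beta>"
  proof -
    consider "\<alpha> = 0" "\<beta> = 0" | "\<alpha> > 0" | "\<beta> > 0"
      using \<open>\<alpha> \<ge> 0\<close> \<open>\<beta> \<ge> 0\<close> by linarith
    then show ?thesis
    proof cases
      case 1
      then show ?thesis using quad[of 1 1] quad[of 1 "-1"] by simp
    next
      case 2
      have "0 \<le> \<alpha> * (\<alpha> * \<beta> - \<gamma>\<^sup>2)"
        using quad[of \<gamma> \<alpha>] by (simp add: power2_eq_square algebra_simps)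
      with 2 show ?thesis by (simp add: zero_le_mult_iff)
    next
      case 3
      have "0 \<le> \<beta> * (\<alpha> * \<beta> - \<gamma>\<^sup>2)"
        using quad[of \<beta> \<gamma>] by (simp add: power2_eq_square algebra_simps)
      with 3 show ?thesis by (simp add: zero_le_mult_iff)
    qed
  qed
  then show "(LINT x|M. f x * g x)\<^sup>2 \<le> (LINT x|M. (f x)\<^sup>2) * (LINT x|M. (g x)\<^sup>2)"
    by (simp add: \<alpha>_def \<beta>_def \<gamma>_def)
qed

lemma PiM_density:
  fixes f :: "'i \<Rightarrow> 'a \<Rightarrow> real"
  assumes Q: "prob_space Q" and fin: "finite I"
    and f: "\<And>i. i \<in> I \<Longrightarrow> integrable Q (f i)" "\<And>i x. i \<in> I \<Longrightarrow> 0 \<le> f i x"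
      "\<And>i. i \<in> I \<Longrightarrow> (LINT x|Q. f i x) = 1"
  shows "(\<Pi>\<^sub>M i\<in>I. density Q (\<lambda>x. ennreal (f i x))) =
    density (\<Pi>\<^sub>M i\<in>I. Q) (\<lambda>x. ennreal (\<Prod>i\<in>I. f i (x i)))"
proof -
  interpret Q: prob_space Q by fact
  interpret P: product_sigma_finite "\<lambda>i. Q" by standard
  define M where "M i = (if i \<in> I then density Q (\<lambda>x. ennreal (f i x)) else Q)" for i
  have meas[measurable]: "f i \<in> borel_measurable Q" if "i \<in> I" for i using f(1)[OF that] by auto
  have "prob_space (M i)" for i
  proof (cases "i \<in> I")
    case True
    have "emeasure (density Q (\<lambda>x. ennreal (f i x))) (space Q) = 1"
      using f[OF True] True by (simp add: emeasure_density nn_integral_eq_integral cong: nn_integral_cong)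
    then show ?thesis by (auto simp: M_def True intro!: prob_spaceI)
  qed (simp add: M_def Q)
  then interpret M: product_prob_space M I
    unfolding product_prob_space_def product_prob_space_axioms_def product_sigma_finite_def
    by (simp add: prob_space_imp_sigma_finite)
  have sets_M: "sets (M i) = sets Q" for i by (simp add: M_def)
  have meas_prod[measurable]: "(\<lambda>x. \<Prod>i\<in>I. f i (x i)) \<in> borel_measurable (\<Pi>\<^sub>M i\<in>I. Q)"
    using meas by (intro borel_measurable_prod measurable_compose[OF measurable_component_singleton]) auto
  have "density (\<Pi>\<^sub>M i\<in>I. Q) (\<lambda>x. ennreal (\<Prod>i\<in>I. f i (x i))) = PiM I M"
  proof (rule M.PiM_eqI[OF fin])
    show "sets (density (\<Pi>\<^sub>M i\<in>I. Q) (\<lambda>x. ennreal (\<Prod>i\<in>I. f i (x i)))) = sets (PiM I M)"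
      using sets_M by (auto intro!: sets_PiM_cong)
    fix A assume "\<And>i. i \<in> I \<Longrightarrow> A i \<in> sets (M i)"
    then have A: "A i \<in> sets Q" if "i \<in> I" for i using that sets_M by simp
    have "emeasure (density (\<Pi>\<^sub>M i\<in>I. Q) (\<lambda>x. ennreal (\<Prod>i\<in>I. f i (x i)))) (Pi\<^sub>E I A) =
        (\<integral>\<^sup>+x. ennreal (\<Prod>i\<in>I. f i (x i)) * indicator (Pi\<^sub>E I A) x \<partial>(\<Pi>\<^sub>M i\<in>I. Q))"
      using A fin by (intro emeasure_density) (auto intro!: sets_PiM_I_finite)
    also have "\<dots> = (\<integral>\<^sup>+x. (\<Prod>i\<in>I. ennreal (f i (x i)) * indicator (A i) (x i)) \<partial>(\<Pi>\<^sub>M i\<in>I. Q))"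
    proof (rule nn_integral_cong)
      fix x assume x: "x \<in> space (\<Pi>\<^sub>M i\<in>I. Q)"
      have "indicator (Pi\<^sub>E I A) x = (\<Prod>i\<in>I. indicator (A i) (x i) :: ennreal)"
      proof (cases "\<forall>i\<in>I. x i \<in> A i")
        case True
        then show ?thesis using x by (auto simp: indicator_def space_PiM PiE_iff)
      next
        case False
        then obtain i where "i \<in> I" "x i \<notin> A i" by blast
        moreover have "(\<Prod>i\<in>I. indicator (A i) (x i) :: ennreal) = 0"
          using calculation by (intro prod_zero[OF fin] bexI[of _ i]) simp_all
        moreover have "x \<notin> Pi\<^sub>E I A"
          using \<open>i \<in> I\<close> \<open>x i \<notin> A i\<close> by (auto simp: PiE_iff)
        ultimately show ?thesis by (metis indicator_simps(2))
      qed
      then show "ennreal (\<Prod>i\<in>I. f i (x i)) * indicator (Pi\<^sub>E I A) x =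
          (\<Prod>i\<in>I. ennreal (f i (x i)) * indicator (A i) (x i))"
        using f(2) by (simp add: prod.distrib prod_ennreal)
    qed
    also have "\<dots> = (\<Prod>i\<in>I. \<integral>\<^sup>+x. ennreal (f i x) * indicator (A i) x \<partial>Q)"
      using A by (intro P.product_nn_integral_prod[OF fin]) auto
    also have "\<dots> = (\<Prod>i\<in>I. emeasure (M i) (A i))"
      using A by (intro prod.cong refl) (simp add: M_def emeasure_density)
    finally show "emeasure (density (\<Pi>\<^sub>M i\<in>I. Q) (\<lambda>x. ennreal (\<Prod>i\<in>I. f i (x i)))) (Pi\<^sub>E I A) =
        (\<Prod>i\<in>I. emeasure (M i) (A i))" .
  qed
  also have "PiM I M = (\<Pi>\<^sub>M i\<in>I. density Q (\<lambda>x. ennreal (f i x)))"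
    by (intro PiM_cong) (auto simp: M_def)
  finally show ?thesis by simp
qed

lemma integral_PiM_density:
  fixes f :: "'i \<Rightarrow> 'a \<Rightarrow> real" and T :: "('i \<Rightarrow> 'a) \<Rightarrow> real"
  assumes Q: "prob_space Q" and fin: "finite I"
    and f: "\<And>i. i \<in> I \<Longrightarrow> integrable Q (f i)" "\<And>i x. i \<in> I \<Longrightarrow> 0 \<le> f i x"
      "\<And>i. i \<in> I \<Longrightarrow> (LINT x|Q. f i x) = 1"
    and T: "T \<in> borel_measurable (\<Pi>\<^sub>M i\<in>I. Q)"
  shows "(LINT x|(\<Pi>\<^sub>M i\<in>I. density Q (\<lambda>x. ennreal (f i x))). T x) =
    (LINT x|(\<Pi>\<^sub>M i\<in>I. Q). (\<Prod>i\<in>I. f i (x i)) * T x)"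
proof -
  have meas: "f i \<in> borel_measurable Q" if "i \<in> I" for i using f(1)[OF that] by auto
  have "(\<lambda>x. \<Prod>i\<in>I. f i (x i)) \<in> borel_measurable (\<Pi>\<^sub>M i\<in>I. Q)"
    using meas by (intro borel_measurable_prod measurable_compose[OF measurable_component_singleton]) auto
  then show ?thesis
    using T f by (subst PiM_density[OF Q fin]; (subst integral_density)?) (auto intro!: prod_nonneg)
qed

text \<open>
  Exchangeability of the coordinates of an independent and identically distributed sample.
\<close>

lemma integral_PiM_permute:
  fixes F :: "('i \<Rightarrow> 'a) \<Rightarrow> real"
  assumes Q: "prob_space Q" and fin: "finite I" and p: "p permutes I"
    and F: "F \<in> borel_measurable (\<Pi>\<^sub>M i\<in>I. Q)"
  shows "(LINT x|(\<Pi>\<^sub>M i\<in>I. Q). F (x \<circ> p)) = (LINT x|(\<Pi>\<^sub>M i\<in>I. Q). F x)"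
proof -
  let ?P = "\<Pi>\<^sub>M i\<in>I. Q"
  have in_I: "p i \<in> I" if "i \<in> I" for i using that permutes_in_image[OF p] by simp
  have "distr ?P ?P (\<lambda>x. \<lambda>i\<in>I. x (p i)) = ?P"
    using distr_PiM_reindex[of I "\<lambda>_. Q" p I] Q permutes_inj_on[OF p] in_I by auto
  moreover have "(\<lambda>x. \<lambda>i\<in>I. x (p i)) \<in> measurable ?P ?P"
    using in_I by (intro measurable_restrict measurable_component_singleton)
  ultimately have "(LINT x|?P. F x) = (LINT x|?P. F (\<lambda>i\<in>I. x (p i)))"
    using integral_distr[OF _ F, of "\<lambda>x. \<lambda>i\<in>I. x (p i)" ?P] by simp
  also have "\<dots> = (LINT x|?P. F (x \<circ> p))"
  proof (rule Bochner_Integration.integral_cong[OF refl])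
    fix x assume "x \<in> space ?P"
    then have "(\<lambda>i\<in>I. x (p i)) = x \<circ> p"
      using permutes_not_in[OF p] by (auto simp: space_PiM fun_eq_iff PiE_iff extensional_def)
    then show "F (\<lambda>i\<in>I. x (p i)) = F (x \<circ> p)" by simp
  qed
  finally show ?thesis by simp
qed

text \<open>
  The two product densities differ by one factor, and all other factors integrate to 1.
\<close>

lemma PiM_density_change_one:
  fixes f g :: "'i \<Rightarrow> 'a \<Rightarrow> real" and T :: "('i \<Rightarrow> 'a) \<Rightarrow> real"
  assumes Q: "prob_space Q" and fin: "finite I" and j: "j \<in> I"
    and f: "\<And>i. i \<in> I \<Longrightarrow> integrable Q (f i)" "\<And>i x. i \<in> I \<Longrightarrow> 0 \<le> f i x"
      "\<And>i. i \<in> I \<Longrightarrow> (LINT x|Q. f i x) = 1"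
    and g: "\<And>i. i \<in> I \<Longrightarrow> integrable Q (g i)" "\<And>i x. i \<in> I \<Longrightarrow> 0 \<le> g i x"
      "\<And>i. i \<in> I \<Longrightarrow> (LINT x|Q. g i x) = 1"
    and same: "\<And>i. i \<in> I \<Longrightarrow> i \<noteq> j \<Longrightarrow> g i = f i"
    and T_meas: "T \<in> borel_measurable (\<Pi>\<^sub>M i\<in>I. Q)"
    and T_range: "\<And>x. x \<in> space (\<Pi>\<^sub>M i\<in>I. Q) \<Longrightarrow> T x \<in> {0..1}"
  shows "\<bar>(LINT x|(\<Pi>\<^sub>M i\<in>I. density Q (\<lambda>x. ennreal (f i x))). T x) -
      (LINT x|(\<Pi>\<^sub>M i\<in>I. density Q (\<lambda>x. ennreal (g i x))). T x)\<bar>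
    \<le> (LINT x|Q. \<bar>f j x - g j x\<bar>)"
proof -
  interpret Q: prob_space Q by fact
  interpret P: product_prob_space "\<lambda>i. Q" I by standard
  let ?P = "\<Pi>\<^sub>M i\<in>I. Q"
  define k where "k i x = (if i = j then \<bar>f j x - g j x\<bar> else f i x)" for i x
  define F G where "F x = (\<Prod>i\<in>I. f i (x i))" and "G x = (\<Prod>i\<in>I. g i (x i))" for x
  have T_bound: "\<bar>T x\<bar> \<le> 1" if "x \<in> space ?P" for x using T_range[OF that] by simp
  have F_int: "integrable ?P F" and G_int: "integrable ?P G"
    unfolding F_def[abs_def] G_def[abs_def]
    using f(1) g(1) by (auto intro!: P.product_integrable_prod[OF fin])
  have times_T: "integrable ?P (\<lambda>x. u x * T x)" if "integrable ?P u" for u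
    by (rule Bochner_Integration.integrable_bound[OF that])
      (use T_bound that T_meas in \<open>auto intro!: AE_I2 mult_left_le simp: abs_mult\<close>)
  have k_int: "integrable Q (k i)" if "i \<in> I" for i
    using f(1) g(1) j that by (cases "i = j") (auto simp: k_def[abs_def])
  have FG: "\<bar>F x - G x\<bar> = (\<Prod>i\<in>I. k i (x i))" for x
  proof -
    have G: "G x = g j (x j) * (\<Prod>i\<in>I - {j}. f i (x i))"
      unfolding G_def prod.remove[OF fin j] using same by simp
    have "F x - G x = (f j (x j) - g j (x j)) * (\<Prod>i\<in>I - {j}. f i (x i))"
      unfolding G F_def prod.remove[OF fin j] by (simp add: algebra_simps)
    moreover have "(\<Prod>i\<in>I - {j}. f i (x i)) \<ge> 0"
      using f(2) by (intro prod_nonneg) auto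
    moreover have "(\<Prod>i\<in>I - {j}. k i (x i)) = (\<Prod>i\<in>I - {j}. f i (x i))"
      by (intro prod.cong) (auto simp: k_def)
    ultimately show ?thesis
      unfolding prod.remove[OF fin j] by (simp add: k_def abs_mult)
  qed
  have "(LINT x|(\<Pi>\<^sub>M i\<in>I. density Q (\<lambda>x. ennreal (f i x))). T x) -
      (LINT x|(\<Pi>\<^sub>M i\<in>I. density Q (\<lambda>x. ennreal (g i x))). T x) =
      (LINT x|?P. F x * T x) - (LINT x|?P. G x * T x)"
    using integral_PiM_density[OF Q fin f T_meas] integral_PiM_density[OF Q fin g T_meas]
    by (simp add: F_def G_def)
  also have "\<dots> = (LINT x|?P. (F x - G x) * T x)"
    using times_T[OF F_int] times_T[OF G_int] by (simp add: left_diff_distrib)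
  also have "\<bar>\<dots>\<bar> \<le> (LINT x|?P. \<bar>(F x - G x) * T x\<bar>)"
    by (rule integral_abs_bound)
  also have "\<dots> \<le> (LINT x|?P. \<bar>F x - G x\<bar>)"
    by (rule integral_mono_AE')
      (use T_bound F_int G_int in \<open>auto intro!: AE_I2 mult_left_le simp: abs_mult\<close>)
  also have "\<dots> = (\<Prod>i\<in>I. LINT x|Q. k i x)"
    unfolding FG using k_int by (intro P.product_integral_prod[OF fin]) auto
  also have "\<dots> = (LINT x|Q. \<bar>f j x - g j x\<bar>)"
  proof -
    have "(LINT x|Q. k i x) = 1" if "i \<in> I - {j}" for i
      using f(3) that by (simp add: k_def)
    then have "(\<Prod>i\<in>I - {j}. LINT x|Q. k i x) = 1"
      by (intro prod.neutral ballI)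
    moreover have "(LINT x|Q. k j x) = (LINT x|Q. \<bar>f j x - g j x\<bar>)"
      by (simp add: k_def)
    ultimately show ?thesis
      unfolding prod.remove[OF fin j] by simp
  qed
  finally show ?thesis .
qed

text \<open>
  Coordinates are exchanged one at a time; \<open>m J\<close> below is the family in which those in \<open>J\<close> have
  been exchanged already.
\<close>

lemma PiM_density_L1_perturbation:
  fixes f g :: "'i \<Rightarrow> 'a \<Rightarrow> real" and T :: "('i \<Rightarrow> 'a) \<Rightarrow> real"
  assumes Q: "prob_space Q" and fin: "finite I"
    and f: "\<And>i. i \<in> I \<Longrightarrow> integrable Q (f i)" "\<And>i x. i \<in> I \<Longrightarrow> 0 \<le> f i x"
      "\<And>i. i \<in> I \<Longrightarrow> (LINT x|Q. f i x) = 1"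
    and g: "\<And>i. i \<in> I \<Longrightarrow> integrable Q (g i)" "\<And>i x. i \<in> I \<Longrightarrow> 0 \<le> g i x"
      "\<And>i. i \<in> I \<Longrightarrow> (LINT x|Q. g i x) = 1"
    and T_meas: "T \<in> borel_measurable (\<Pi>\<^sub>M i\<in>I. Q)"
    and T_range: "\<And>x. x \<in> space (\<Pi>\<^sub>M i\<in>I. Q) \<Longrightarrow> T x \<in> {0..1}"
  shows "\<bar>(LINT x|(\<Pi>\<^sub>M i\<in>I. density Q (\<lambda>x. ennreal (f i x))). T x) -
      (LINT x|(\<Pi>\<^sub>M i\<in>I. density Q (\<lambda>x. ennreal (g i x))). T x)\<bar>
    \<le> (\<Sum>i\<in>I. LINT x|Q. \<bar>f i x - g i x\<bar>)"
proof -
  define m where "m J i = (if i \<in> J then g i else f i)" for J i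
  define E where "E u = (LINT x|(\<Pi>\<^sub>M i\<in>I. density Q (\<lambda>x. ennreal (u i x))). T x)" for u
  have m: "integrable Q (m J i)" "0 \<le> m J i x" "(LINT x|Q. m J i x) = 1" if "i \<in> I" for J i x
    using f g that by (auto simp: m_def)
  have "\<bar>E f - E (m J)\<bar> \<le> (\<Sum>i\<in>J. LINT x|Q. \<bar>f i x - g i x\<bar>)" if "J \<subseteq> I" for J
    using finite_subset[OF that fin] that
  proof (induction J rule: finite_induct)
    case empty
    then show ?case by (simp add: m_def[abs_def])
  next
    case (insert j J)
    have "\<bar>E (m J) - E (m (insert j J))\<bar> \<le> (LINT x|Q. \<bar>m J j x - m (insert j J) j x\<bar>)"
      unfolding E_def
      by (rule PiM_density_change_one[OF Q fin _ m m])
        (use insert.prems T_meas T_range in \<open>auto simp: m_def\<close>)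
    also have "\<dots> = (LINT x|Q. \<bar>f j x - g j x\<bar>)"
      using insert.hyps by (simp add: m_def)
    finally show ?case using insert by simp
  qed
  from this[OF subset_refl] have "\<bar>E f - E (m I)\<bar> \<le> (\<Sum>i\<in>I. LINT x|Q. \<bar>f i x - g i x\<bar>)" .
  moreover have "E (m I) = E g"
    unfolding E_def by (intro arg_cong2[where f = "integral\<^sup>L"] PiM_cong refl) (simp add: m_def)
  ultimately show ?thesis by (simp add: E_def)
qed

section \<open>Permutation mixtures and independent samples\<close>

lemma integral_double_sum:
  fixes g :: "'i \<Rightarrow> 'j \<Rightarrow> 'a \<Rightarrow> real"
  assumes "\<And>i j. i \<in> I \<Longrightarrow> j \<in> J \<Longrightarrow> integrable M (g i j)"
  shows "(LINT x|M. (\<Sum>i\<in>I. \<Sum>j\<in>J. g i j x)) = (\<Sum>i\<in>I. \<Sum>j\<in>J. LINT x|M. g i j x)"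
  using assms by (simp add: Bochner_Integration.integral_sum)

text \<open>
  The invariance of \<open>T\<close> allows the density of the product law to be replaced by its average \<open>Lbar\<close>
  over all permutations of the coordinates. Since \<open>T\<close> takes values in the unit interval, the
  difference of the expectations is at most the \<open>L\<^sup>1\<close> norm of \<open>Lbar - 1\<close>, hence at most
  its \<open>L\<^sup>2\<close> norm. The second moment of \<open>Lbar\<close> factorises over coordinates into a mean permutation
  product. Cauchy-Schwarz alone would give \<open>a = card I * s\<close>, for which the bound does not tend to 0;
  a smaller \<open>a\<close> expresses that the \<open>f i - 1\<close> nearly cancel in the sum.
\<close>

lemma permutation_mixture_close_to_iid:
  fixes f :: "'i \<Rightarrow> 'a \<Rightarrow> real" and T :: "('i \<Rightarrow> 'a) \<Rightarrow> real"
  assumes Q: "prob_space Q" and fin: "finite I" and n: "2 \<le> card I"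
    and f_meas: "\<And>i. i \<in> I \<Longrightarrow> f i \<in> borel_measurable Q"
    and f_nonneg: "\<And>i x. i \<in> I \<Longrightarrow> 0 \<le> f i x"
    and h2: "\<And>i. i \<in> I \<Longrightarrow> integrable Q (\<lambda>x. (f i x - 1)\<^sup>2)"
    and f_int: "\<And>i. i \<in> I \<Longrightarrow> (LINT x|Q. f i x) = 1"
    and s: "(\<Sum>i\<in>I. LINT x|Q. (f i x - 1)\<^sup>2) \<le> s"
    and a: "(LINT x|Q. (\<Sum>i\<in>I. f i x - 1)\<^sup>2) \<le> a"
    and T_meas: "T \<in> borel_measurable (\<Pi>\<^sub>M i\<in>I. Q)"
    and T_range: "\<And>x. x \<in> space (\<Pi>\<^sub>M i\<in>I. Q) \<Longrightarrow> T x \<in> {0..1}"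
    and T_inv: "\<And>p x. p permutes I \<Longrightarrow> x \<in> space (\<Pi>\<^sub>M i\<in>I. Q) \<Longrightarrow> T (x \<circ> p) = T x"
  shows "\<bar>(LINT x|(\<Pi>\<^sub>M i\<in>I. density Q (\<lambda>x. ennreal (f i x))). T x) - (LINT x|(\<Pi>\<^sub>M i\<in>I. Q). T x)\<bar>
    \<le> sqrt (exp s * sqrt ((a\<^sup>2 + 2 * s\<^sup>2) / card I))"
proof -
  interpret Q: prob_space Q by fact
  interpret P: product_prob_space "\<lambda>i. Q" I
    by standard
  let ?P = "\<Pi>\<^sub>M i\<in>I. Q" and ?S = "{p. p permutes I}" and ?N = "fact (card I) :: real"
  have P1: "measure ?P (space ?P) = 1"
    by (intro prob_space.prob_space prob_space_PiM Q)
  define h where "h i x = f i x - 1" for i x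
  define A where "A i k = (LINT x|Q. h i x * h k x)" for i k
  define L where "L p x = (\<Prod>i\<in>I. f (p i) (x i))" for p x
  define Lbar where "Lbar x = (\<Sum>p\<in>?S. L p x) / ?N" for x
  note [measurable] = T_meas
  have h_meas: "h i \<in> borel_measurable Q" if "i \<in> I" for i
    using f_meas[OF that] unfolding h_def by measurable
  have h_int: "integrable Q (h i)" if "i \<in> I" for i
    by (rule Q.square_integrable_imp_integrable[OF h_meas[OF that]])
      (use h2[OF that] in \<open>simp only: h_def\<close>)
  have f_eq: "f i x = 1 + h i x" for i x by (simp add: h_def)
  have f_integrable: "integrable Q (f i)" if "i \<in> I" for i
  proof -
    have "integrable Q (\<lambda>x. h i x + 1)" using h_int[OF that] by simp
    then show ?thesis by (simp add: h_def)
  qed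
  have h_mean: "(LINT x|Q. h i x) = 0" if "i \<in> I" for i
    using f_int[OF that] f_integrable[OF that] by (simp add: h_def Q.prob_space)
  have hh: "integrable Q (\<lambda>x. h i x * h k x)"
    "(A i k)\<^sup>2 \<le> (LINT x|Q. (h i x)\<^sup>2) * (LINT x|Q. (h k x)\<^sup>2)" if "i \<in> I" "k \<in> I" for i k
    using Cauchy_Schwarz_integral[OF h_meas[OF that(1)] h_meas[OF that(2)]] h2[OF that(1)] h2[OF that(2)]
    by (auto simp: h_def A_def)
  have ff: "integrable Q (\<lambda>x. f i x * f k x)" "(LINT x|Q. f i x * f k x) = 1 + A i k"
    if "i \<in> I" "k \<in> I" for i k
  proof -
    have *: "f i x * f k x = 1 + h i x + h k x + h i x * h k x" for x
      by (simp add: h_def algebra_simps)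
    show "integrable Q (\<lambda>x. f i x * f k x)" "(LINT x|Q. f i x * f k x) = 1 + A i k"
      unfolding * using h_int[OF that(1)] h_int[OF that(2)] hh(1)[OF that] h_mean[OF that(1)] h_mean[OF that(2)]
      by (auto simp: A_def Q.prob_space)
  qed
  have in_I: "p i \<in> I" if "p \<in> ?S" "i \<in> I" for p i
    using that permutes_in_image[of p I] by simp
  have L_int: "integrable ?P (L p)" "(LINT x|?P. L p x) = 1" if p: "p \<in> ?S" for p
  proof -
    show "integrable ?P (L p)"
      unfolding L_def[abs_def] using f_integrable in_I[OF p] by (intro P.product_integrable_prod[OF fin]) auto
    have "(LINT x|?P. L p x) = (\<Prod>i\<in>I. LINT x|Q. f (p i) x)"
      unfolding L_def[abs_def] using f_integrable in_I[OF p] by (intro P.product_integral_prod[OF fin]) auto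
    then show "(LINT x|?P. L p x) = 1" using f_int in_I[OF p] by simp
  qed
  have LL_int: "integrable ?P (\<lambda>x. L p x * L q x)"
    "(LINT x|?P. L p x * L q x) = (\<Prod>i\<in>I. 1 + A (p i) (q i))" if p: "p \<in> ?S" and q: "q \<in> ?S" for p q
  proof -
    have *: "L p x * L q x = (\<Prod>i\<in>I. f (p i) (x i) * f (q i) (x i))" for x
      by (simp add: L_def prod.distrib)
    show "integrable ?P (\<lambda>x. L p x * L q x)"
      unfolding * using ff(1) in_I p q by (intro P.product_integrable_prod[OF fin]) auto
    have "(LINT x|?P. L p x * L q x) = (\<Prod>i\<in>I. LINT x|Q. f (p i) x * f (q i) x)"
      unfolding * using ff(1) in_I p q by (intro P.product_integral_prod[OF fin]) auto
    then show "(LINT x|?P. L p x * L q x) = (\<Prod>i\<in>I. 1 + A (p i) (q i))"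
      using ff(2) in_I p q by simp
  qed
  have cardS: "real (card ?S) = ?N" using fin by (simp add: card_permutations)
  have Lbar_int: "integrable ?P Lbar" "(LINT x|?P. Lbar x) = 1"
  proof -
    show "integrable ?P Lbar"
      unfolding Lbar_def[abs_def] using L_int(1)
      by (intro integrable_divide_zero Bochner_Integration.integrable_sum)
    show "(LINT x|?P. Lbar x) = 1"
      unfolding Lbar_def[abs_def] using L_int cardS by (simp add: Bochner_Integration.integral_sum)
  qed
  have Lbar_sq: "(Lbar x)\<^sup>2 = (\<Sum>p\<in>?S. \<Sum>q\<in>?S. L p x * L q x) / ?N\<^sup>2" for x
    by (simp add: Lbar_def power_divide sum_product power2_eq_square)
  have Lbar2_int: "integrable ?P (\<lambda>x. (Lbar x)\<^sup>2)"
    unfolding Lbar_sq using LL_int(1)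
    by (intro integrable_divide_zero Bochner_Integration.integrable_sum)
  have Lbar2: "(LINT x|?P. (Lbar x)\<^sup>2) = (\<Sum>p\<in>?S. \<Prod>i\<in>I. 1 + A i (p i)) / ?N"
  proof -
    have "(LINT x|?P. (Lbar x)\<^sup>2) = (\<Sum>p\<in>?S. \<Sum>q\<in>?S. \<Prod>i\<in>I. 1 + A (p i) (q i)) / ?N\<^sup>2"
    proof -
      have "(LINT x|?P. (\<Sum>p\<in>?S. \<Sum>q\<in>?S. L p x * L q x)) =
          (\<Sum>p\<in>?S. \<Sum>q\<in>?S. LINT x|?P. L p x * L q x)"
        by (rule integral_double_sum) (rule LL_int(1))
      also have "\<dots> = (\<Sum>p\<in>?S. \<Sum>q\<in>?S. \<Prod>i\<in>I. 1 + A (p i) (q i))"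
        by (intro sum.cong refl LL_int(2))
      finally show ?thesis unfolding Lbar_sq integral_divide_zero by simp
    qed
    \<comment> \<open>The product depends on \<open>p\<close> and \<open>q\<close> only through \<open>q \<circ> inv p\<close>, which runs over all permutations
      as \<open>q\<close> does.\<close>
    also have "(\<Sum>p\<in>?S. \<Sum>q\<in>?S. \<Prod>i\<in>I. 1 + A (p i) (q i)) =
        (\<Sum>p\<in>?S. \<Sum>q\<in>?S. \<Prod>i\<in>I. 1 + A i (q i))"
    proof (rule sum.cong[OF refl])
      fix p assume "p \<in> ?S"
      then have p: "p permutes I" by simp
      have "(\<Sum>q\<in>?S. \<Prod>i\<in>I. 1 + A i (q i)) = (\<Sum>q\<in>?S. \<Prod>i\<in>I. 1 + A i ((q \<circ> inv p) i))"
        by (rule sum_permutations_compose_right[OF permutes_inv[OF p]])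
      also have "\<dots> = (\<Sum>q\<in>?S. \<Prod>i\<in>I. 1 + A (p i) ((q \<circ> inv p) (p i)))"
        by (intro sum.cong refl prod.reindex_bij_betw[OF permutes_imp_bij[OF p], symmetric])
      finally show "(\<Sum>q\<in>?S. \<Prod>i\<in>I. 1 + A (p i) (q i)) = (\<Sum>q\<in>?S. \<Prod>i\<in>I. 1 + A i (q i))"
        using permutes_inverses(2)[OF p] by simp
    qed
    also have "\<dots> = ?N * (\<Sum>q\<in>?S. \<Prod>i\<in>I. 1 + A i (q i))" using cardS by simp
    finally show ?thesis by (simp add: power2_eq_square)
  qed
  have "(\<Sum>i\<in>I. \<Sum>k\<in>I. A i k) = (LINT x|Q. (\<Sum>i\<in>I. h i x)\<^sup>2)"
    using hh(1) by (simp add: A_def power2_eq_square sum_product integral_double_sum)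
  then have tot: "\<bar>\<Sum>i\<in>I. \<Sum>k\<in>I. A i k\<bar> \<le> a"
    using a by (simp add: h_def)
  have chi2: "(LINT x|?P. (Lbar x)\<^sup>2) \<le> 1 + exp s * sqrt ((a\<^sup>2 + 2 * s\<^sup>2) / card I)"
    unfolding Lbar2
  proof (rule mean_permutation_product_le[OF fin n, where u = "\<lambda>i. LINT x|Q. (h i x)\<^sup>2"])
    show "0 \<le> 1 + A i k" if "i \<in> I" "k \<in> I" for i k
      using f_nonneg[OF that(1)] f_nonneg[OF that(2)]
      unfolding ff(2)[OF that, symmetric] by (intro Bochner_Integration.integral_nonneg) auto
  qed (use hh(2) s tot in \<open>auto simp: h_def\<close>)
  have T_bound: "\<bar>T x\<bar> \<le> 1" if "x \<in> space ?P" for x using T_range[OF that] by simp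
  have TL_int: "integrable ?P (\<lambda>x. L p x * T x)" if "p \<in> ?S" for p
    by (rule Bochner_Integration.integrable_bound[OF L_int(1)[OF that]])
      (use T_bound L_int(1)[OF that] in \<open>auto intro!: AE_I2 mult_left_le simp: abs_mult\<close>)
  have T_int: "integrable ?P T"
    by (rule Bochner_Integration.integrable_bound[where f = "\<lambda>_. 1 :: real"])
      (use T_bound in \<open>auto intro!: AE_I2\<close>)
  have LbarT: "Lbar x * T x = (\<Sum>p\<in>?S. L p x * T x) / ?N" for x
    by (simp add: Lbar_def sum_distrib_right)
  have LbarT_int: "integrable ?P (\<lambda>x. Lbar x * T x)"
    unfolding LbarT using TL_int by (intro integrable_divide_zero Bochner_Integration.integrable_sum)
  have LT: "(LINT x|?P. L p x * T x) = (LINT x|?P. L id x * T x)" if "p \<in> ?S" for p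
  proof -
    have p: "p permutes I" using that by simp
    have q: "inv p permutes I" by (rule permutes_inv[OF p])
    have "(LINT x|?P. L id x * T x) = (LINT x|?P. L id (x \<circ> inv p) * T (x \<circ> inv p))"
      using TL_int[of id] by (intro integral_PiM_permute[OF Q fin q, symmetric]) (auto simp: permutes_id)
    also have "\<dots> = (LINT x|?P. L p x * T x)"
    proof (rule Bochner_Integration.integral_cong[OF refl])
      fix x assume x: "x \<in> space ?P"
      have "L id (x \<circ> inv p) = (\<Prod>i\<in>I. f (p i) (x (inv p (p i))))"
        using prod.reindex_bij_betw[OF permutes_imp_bij[OF p], of "\<lambda>i. f i (x (inv p i))"]
        by (simp add: L_def)
      then show "L id (x \<circ> inv p) * T (x \<circ> inv p) = L p x * T x"
        using T_inv[OF q x] permutes_inverses(2)[OF p] by (simp add: L_def)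
    qed
    finally show ?thesis by simp
  qed
  have "(LINT x|(\<Pi>\<^sub>M i\<in>I. density Q (\<lambda>x. ennreal (f i x))). T x) = (LINT x|?P. L id x * T x)"
    using integral_PiM_density[OF Q fin f_integrable f_nonneg f_int T_meas] by (simp add: L_def)
  also have "\<dots> = (\<Sum>p\<in>?S. LINT x|?P. L p x * T x) / ?N"
  proof -
    have "(\<Sum>p\<in>?S. LINT x|?P. L p x * T x) = (\<Sum>p\<in>?S. LINT x|?P. L id x * T x)"
      by (intro sum.cong refl LT)
    then show ?thesis using cardS by simp
  qed
  also have "\<dots> = (LINT x|?P. Lbar x * T x)"
    unfolding LbarT integral_divide_zero
    by (subst Bochner_Integration.integral_sum) (use TL_int in auto)
  finally have "(LINT x|(\<Pi>\<^sub>M i\<in>I. density Q (\<lambda>x. ennreal (f i x))). T x) - (LINT x|?P. T x) =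
      (LINT x|?P. Lbar x * T x - T x)"
    using LbarT_int T_int by simp
  also have "\<bar>\<dots>\<bar> \<le> (LINT x|?P. \<bar>Lbar x - 1\<bar>)"
  proof -
    have "\<bar>LINT x|?P. Lbar x * T x - T x\<bar> \<le> (LINT x|?P. \<bar>Lbar x * T x - T x\<bar>)"
      by (rule integral_abs_bound)
    also have "\<dots> \<le> (LINT x|?P. \<bar>Lbar x - 1\<bar>)"
    proof (rule integral_mono_AE')
      show "AE x in ?P. \<bar>Lbar x * T x - T x\<bar> \<le> \<bar>Lbar x - 1\<bar>"
      proof (rule AE_I2)
        fix x assume "x \<in> space ?P"
        then have "\<bar>Lbar x - 1\<bar> * \<bar>T x\<bar> \<le> \<bar>Lbar x - 1\<bar>"
          using T_bound by (intro mult_left_le) auto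
        then show "\<bar>Lbar x * T x - T x\<bar> \<le> \<bar>Lbar x - 1\<bar>"
          by (simp add: abs_mult[symmetric] left_diff_distrib)
      qed
    qed (use Lbar_int in auto)
    finally show ?thesis .
  qed
  also have "\<dots> \<le> sqrt (exp s * sqrt ((a\<^sup>2 + 2 * s\<^sup>2) / card I))"
  proof (rule real_le_rsqrt)
    have sq_int: "integrable ?P (\<lambda>x. \<bar>Lbar x - 1\<bar>\<^sup>2)" 
      and sq_eq: "(LINT x|?P. \<bar>Lbar x - 1\<bar>\<^sup>2) = (LINT x|?P. (Lbar x)\<^sup>2) - 1"
      using Lbar_int Lbar2_int by (simp_all add: power2_diff P1)
    have "(LINT x|?P. \<bar>Lbar x - 1\<bar> * 1)\<^sup>2 \<le> (LINT x|?P. \<bar>Lbar x - 1\<bar>\<^sup>2) * (LINT x|?P. 1\<^sup>2)"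
      using Lbar_int(1) sq_int by (intro Cauchy_Schwarz_integral) auto
    then show "(LINT x|?P. \<bar>Lbar x - 1\<bar>)\<^sup>2 \<le> exp s * sqrt ((a\<^sup>2 + 2 * s\<^sup>2) / card I)"
      using chi2 sq_eq by (simp add: P1)
  qed
  finally show ?thesis .
qed

section \<open>Exponential tilts\<close>

lemma exp_first_order_remainder: "\<bar>exp z - 1 - z\<bar> \<le> z\<^sup>2 / 2 * exp \<bar>z\<bar>" for z :: real
proof -
  obtain t where t: "\<bar>t\<bar> \<le> \<bar>z\<bar>" "exp z = (\<Sum>m<2. z ^ m / fact m) + exp t / fact 2 * z ^ 2"
    using Maclaurin_exp_le[of z 2] by blast
  then have "exp z - 1 - z = z\<^sup>2 / 2 * exp t"
    by (simp add: numeral_2_eq_2)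
  then have "\<bar>exp z - 1 - z\<bar> = z\<^sup>2 / 2 * exp t"
    by (simp only: abs_mult abs_divide abs_power2 abs_exp_cancel abs_numeral)
  also have "\<dots> \<le> z\<^sup>2 / 2 * exp \<bar>z\<bar>"
    using t(1) by (intro mult_left_mono) auto
  finally show ?thesis .
qed

text \<open>
  Only the laws of an exponential family with parameter in a compact interval are of interest. A
  common bound \<open>C\<close> on one exponential moment is all the uniformity in the parameter that the
  estimates use.
\<close>

definition exp_moment_le :: "real \<Rightarrow> real \<Rightarrow> real measure \<Rightarrow> bool" where
  "exp_moment_le \<eta> C Q \<longleftrightarrow> prob_space Q \<and> sets Q = sets borel \<and>
    integrable Q (\<lambda>x. exp (\<eta> * \<bar>x\<bar>)) \<and> (LINT x|Q. exp (\<eta> * \<bar>x\<bar>)) \<le> C"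

text \<open>
  The score of the exponential family at parameter 0 is \<open>x - E x\<close>; the claim is a first order Taylor
  expansion of the tilted density with remainder of order \<open>d\<^sup>2\<close>. It is stated pointwise with the
  dominating function \<open>exp (\<eta> / 2 * \<bar>x\<bar>)\<close> because the square of that function is
  \<open>exp (\<eta> * \<bar>x\<bar>)\<close>, whose integral is controlled. Uniformity of \<open>\<epsilon>\<close> and \<open>K\<close> in \<open>Q\<close> is
  what makes the final convergence uniform.
\<close>

lemma exponential_tilt_expansion:
  fixes \<eta> C :: real
  assumes \<eta>: "\<eta> > 0"
  shows "\<exists>\<epsilon> K. 0 < \<epsilon> \<and> \<epsilon> \<le> 1 \<and> 0 \<le> K \<and> (\<forall>Q. exp_moment_le \<eta> C Q \<longrightarrow>
    (\<forall>d x. \<bar>d\<bar> \<le> \<epsilon> \<longrightarrow>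
      \<bar>exp (d * x) / (LINT y|Q. exp (d * y)) - 1 - d * (x - (LINT y|Q. y))\<bar> \<le>
        K * d\<^sup>2 * exp (\<eta> / 2 * \<bar>x\<bar>)) \<and>
    (\<forall>x. \<bar>x - (LINT y|Q. y)\<bar> \<le> K * exp (\<eta> / 2 * \<bar>x\<bar>)))"
proof -
  \<comment> \<open>\<open>k\<close> dominates the constants in \<open>\<bar>x\<bar> \<le> k * H x\<close> and in the remainder of \<open>exp (d * x)\<close>; the choice
    of \<open>\<epsilon>\<close> makes the normalising integral \<open>\<rho>\<close> at least \<open>1 / 2\<close>.\<close>
  define B where "B = max 1 C"
  define k where "k = 2 / \<eta> + 16 / \<eta>\<^sup>2"
  define \<epsilon> where "\<epsilon> = min 1 (min (\<eta> / 4) (1 / (4 * k * B)))"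
  define K where "K = 16 * k\<^sup>2 * B\<^sup>2 + 2 * k * B"
  define H where "H x = exp (\<eta> / 2 * \<bar>x\<bar>)" for x
  have B: "B \<ge> 1" "B \<ge> C" by (auto simp: B_def)
  have k: "k > 0" using \<eta> by (simp add: k_def add_pos_pos)
  have \<epsilon>: "0 < \<epsilon>" "\<epsilon> \<le> 1" "\<epsilon> \<le> \<eta> / 4" "\<epsilon> \<le> 1 / (4 * k * B)"
    using \<eta> k B by (auto simp: \<epsilon>_def)
  have K: "K \<ge> 0" using k B by (simp add: K_def)
  have H1: "H x \<ge> 1" for x using \<eta> by (simp add: H_def)
  have absx: "\<bar>x\<bar> \<le> k * H x" for x
  proof -
    have "\<eta> / 2 * \<bar>x\<bar> \<le> H x"
      using exp_ge_add_one_self[of "\<eta> / 2 * \<bar>x\<bar>"] unfolding H_def by linarith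
    then have "\<bar>x\<bar> \<le> 2 / \<eta> * H x" using \<eta> by (simp add: field_simps)
    also have "\<dots> \<le> k * H x"
      using H1[of x] by (intro mult_right_mono) (simp_all add: k_def)
    finally show ?thesis .
  qed
  have rem: "\<bar>exp (d * x) - 1 - d * x\<bar> \<le> d\<^sup>2 * (k * H x)" if d: "\<bar>d\<bar> \<le> \<epsilon>" for d x
  proof -
    define t where "t = \<eta> / 4 * \<bar>x\<bar>"
    have "t \<ge> 0" using \<eta> by (simp add: t_def)
    have "t\<^sup>2 \<le> 2 * exp t"
      using exp_lower_Taylor_quadratic[OF \<open>t \<ge> 0\<close>] \<open>t \<ge> 0\<close> by simp
    moreover have "x\<^sup>2 = 16 / \<eta>\<^sup>2 * t\<^sup>2"
      using \<eta> by (simp add: t_def power_mult_distrib power_divide)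
    ultimately have x2: "x\<^sup>2 \<le> 32 / \<eta>\<^sup>2 * exp t"
      using \<eta> by (simp add: divide_right_mono)
    have "\<bar>d * x\<bar> \<le> t"
      unfolding t_def abs_mult using d \<epsilon>(3) by (intro mult_right_mono) auto
    have "\<bar>exp (d * x) - 1 - d * x\<bar> \<le> (d * x)\<^sup>2 / 2 * exp \<bar>d * x\<bar>"
      by (rule exp_first_order_remainder)
    also have "\<dots> \<le> (d * x)\<^sup>2 / 2 * exp t"
      using \<open>\<bar>d * x\<bar> \<le> t\<close> by (intro mult_left_mono) auto
    also have "\<dots> = d\<^sup>2 * (x\<^sup>2 * exp t / 2)"
      by (simp add: power_mult_distrib)
    also have "\<dots> \<le> d\<^sup>2 * ((32 / \<eta>\<^sup>2 * exp t) * exp t / 2)"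
      using x2 by (intro mult_left_mono divide_right_mono mult_right_mono) auto
    also have "(32 / \<eta>\<^sup>2 * exp t) * exp t / 2 = 16 / \<eta>\<^sup>2 * H x"
      by (simp add: H_def t_def exp_add[symmetric] mult.assoc)
    also have "d\<^sup>2 * (16 / \<eta>\<^sup>2 * H x) \<le> d\<^sup>2 * (k * H x)"
      using \<eta> H1[of x] by (intro mult_left_mono mult_right_mono) (auto simp: k_def)
    finally show ?thesis .
  qed
  have main: "\<bar>exp (d * x) / (LINT y|Q. exp (d * y)) - 1 - d * (x - (LINT y|Q. y))\<bar> \<le> K * d\<^sup>2 * H x"
    "\<bar>x - (LINT y|Q. y)\<bar> \<le> K * H x"
    if Q: "exp_moment_le \<eta> C Q" and d: "\<bar>d\<bar> \<le> \<epsilon>" for Q d x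
  proof -
    have sets[measurable_cong]: "sets Q = sets borel"
      and int: "integrable Q (\<lambda>x. exp (\<eta> * \<bar>x\<bar>))" and C: "(LINT x|Q. exp (\<eta> * \<bar>x\<bar>)) \<le> C"
      using Q by (auto simp: exp_moment_le_def)
    interpret prob_space Q using Q by (simp add: exp_moment_le_def)
    define e where "e = (LINT y|Q. y)"
    define r where "r x = exp (d * x) - 1 - d * x" for x
    define \<rho> where "\<rho> = (LINT y|Q. exp (d * y))"
    have H_le: "H x \<le> exp (\<eta> * \<bar>x\<bar>)" for x
      using \<eta> by (simp add: H_def)
    have H_meas[measurable]: "H \<in> borel_measurable Q"
      unfolding H_def[abs_def] by measurable
    have H_int: "integrable Q H"
      by (rule Bochner_Integration.integrable_bound[OF int])
        (use H_le in \<open>auto simp: H_def intro!: AE_I2\<close>)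
    have EH: "(LINT x|Q. H x) \<le> B"
    proof -
      have "(LINT x|Q. H x) \<le> (LINT x|Q. exp (\<eta> * \<bar>x\<bar>))"
        by (intro integral_mono H_int int H_le)
      with C B(2) show ?thesis by linarith
    qed
    have dominated: "integrable Q u" "\<bar>LINT y|Q. u y\<bar> \<le> c * B"
      if u: "u \<in> borel_measurable Q" "\<And>x. \<bar>u x\<bar> \<le> c * H x" and c: "c \<ge> 0" for u c
    proof -
      show "integrable Q u"
        by (rule Bochner_Integration.integrable_bound[where f = "\<lambda>x. c * H x"])
          (use u c H_int H1 in \<open>auto intro!: AE_I2 order_trans[OF u(2)]\<close>)
      have "\<bar>LINT y|Q. u y\<bar> \<le> (LINT y|Q. \<bar>u y\<bar>)"
        by (rule integral_abs_bound)
      also have "\<dots> \<le> (LINT y|Q. c * H y)"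
        using u(2) H_int \<open>integrable Q u\<close> by (intro integral_mono) auto
      also have "\<dots> \<le> c * B" using EH c by (simp add: mult_left_mono)
      finally show "\<bar>LINT y|Q. u y\<bar> \<le> c * B" .
    qed
    have x_int: "integrable Q (\<lambda>x. x)" and e: "\<bar>e\<bar> \<le> k * B"
      using dominated[of "\<lambda>x. x" k] absx k by (auto simp: e_def)
    have r_int: "integrable Q r" and Er: "\<bar>LINT y|Q. r y\<bar> \<le> d\<^sup>2 * k * B"
      using dominated[of r "d\<^sup>2 * k"] rem[OF d] k by (auto simp: r_def[abs_def] mult.assoc)
    have exp_eq: "exp (d * x) = 1 + d * x + r x" for x by (simp add: r_def)
    have \<rho>_eq: "\<rho> = 1 + d * e + (LINT y|Q. r y)"
      using x_int r_int by (simp add: \<rho>_def exp_eq e_def prob_space)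
    have d2: "d\<^sup>2 \<le> \<bar>d\<bar>"
      using d \<epsilon>(2) mult_left_le[of "\<bar>d\<bar>" "\<bar>d\<bar>"] by (simp add: power2_eq_square)
    have kH: "k * H x \<le> k * B * H x" "k * B \<le> k * B * H x"
      using mult_right_mono[of k "k * B" "H x"] mult_left_mono[of 1 "H x" "k * B"]
        mult_left_mono[of 1 B k] k B H1[of x] by auto
    show "\<bar>x - (LINT y|Q. y)\<bar> \<le> K * H x"
    proof -
      have "\<bar>x - (LINT y|Q. y)\<bar> \<le> k * H x + k * B"
        using absx[of x] e unfolding e_def by linarith
      also have "\<dots> \<le> k * B * H x + k * B * H x"
        using kH by (intro add_mono)
      also have "\<dots> \<le> K * H x"
        using H1[of x] by (simp add: K_def algebra_simps)
      finally show ?thesis .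
    qed
    show "\<bar>exp (d * x) / (LINT y|Q. exp (d * y)) - 1 - d * (x - (LINT y|Q. y))\<bar> \<le> K * d\<^sup>2 * H x"
    proof -
      have kB: "k * B > 0" using k B by simp
      have \<rho>1: "\<bar>\<rho> - 1\<bar> \<le> \<bar>d\<bar> * (2 * (k * B))"
      proof -
        have "\<bar>\<rho> - 1\<bar> \<le> \<bar>d\<bar> * \<bar>e\<bar> + d\<^sup>2 * k * B"
          using Er abs_mult[of d e] unfolding \<rho>_eq by linarith
        also have "\<dots> \<le> \<bar>d\<bar> * (k * B) + \<bar>d\<bar> * k * B"
          using e d2 k B by (intro add_mono mult_left_mono mult_right_mono) auto
        finally show ?thesis by (simp add: algebra_simps)
      qed
      define v where "v = exp (d * x)"
      have "\<bar>d\<bar> * (2 * (k * B)) \<le> 1 / (4 * k * B) * (2 * (k * B))"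
        using d \<epsilon>(4) kB by (intro mult_right_mono) auto
      also have "\<dots> = 1 / 2" using k B by (simp add: field_simps)
      finally have "\<bar>\<rho> - 1\<bar> \<le> 1 / 2" using \<rho>1 by linarith
      then have \<rho>2: "\<rho> \<ge> 1 / 2" by linarith
      have v1: "\<bar>v - 1\<bar> \<le> \<bar>d\<bar> * (2 * (k * H x))"
      proof -
        have "\<bar>v - 1\<bar> \<le> \<bar>d * x\<bar> + \<bar>exp (d * x) - 1 - d * x\<bar>" by (simp add: v_def)
        also have "\<dots> \<le> \<bar>d\<bar> * (k * H x) + d\<^sup>2 * (k * H x)"
          using rem[OF d, of x] absx[of x] by (intro add_mono) (auto simp: abs_mult mult_left_mono)
        also have "d\<^sup>2 * (k * H x) \<le> \<bar>d\<bar> * (k * H x)"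
          using d2 k H1[of x] by (intro mult_right_mono) auto
        finally show ?thesis by (simp add: algebra_simps)
      qed
      have v\<rho>: "\<bar>v - \<rho>\<bar> \<le> \<bar>d\<bar> * (4 * (k * B * H x))"
      proof -
        have "\<bar>v - \<rho>\<bar> \<le> \<bar>d\<bar> * (2 * (k * H x)) + \<bar>d\<bar> * (2 * (k * B))"
          using v1 \<rho>1 by linarith
        also have "\<dots> = \<bar>d\<bar> * (2 * (k * H x) + 2 * (k * B))" by (simp add: algebra_simps)
        also have "\<dots> \<le> \<bar>d\<bar> * (4 * (k * B * H x))"
          using kH by (intro mult_left_mono) auto
        finally show ?thesis .
      qed
      \<comment> \<open>The numerator \<open>v - \<rho>\<close> has the required form up to \<open>d\<^sup>2\<close>; dividing by \<open>\<rho>\<close> instead of 1 only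
        adds a product of two factors of order \<open>d\<close>.\<close>
      have "v / \<rho> - 1 - d * (x - e) = (v - \<rho>) * (1 - \<rho>) / \<rho> + (r x - (LINT y|Q. r y))"
      proof -
        have "(v - \<rho>) * (1 - \<rho>) / \<rho> = v / \<rho> - 1 - (v - \<rho>)"
          using \<rho>2 by (simp add: field_simps)
        moreover have "v - \<rho> = d * (x - e) + (r x - (LINT y|Q. r y))"
          unfolding v_def exp_eq \<rho>_eq by (simp add: algebra_simps)
        ultimately show ?thesis by linarith
      qed
      also have "\<bar>\<dots>\<bar> \<le> \<bar>(v - \<rho>) * (1 - \<rho>) / \<rho>\<bar> + (\<bar>r x\<bar> + \<bar>LINT y|Q. r y\<bar>)"
        by (intro order_trans[OF abs_triangle_ineq] add_left_mono abs_triangle_ineq4)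
      also have "\<bar>(v - \<rho>) * (1 - \<rho>) / \<rho>\<bar> \<le>
          (\<bar>d\<bar> * (4 * (k * B * H x))) * (\<bar>d\<bar> * (2 * (k * B))) / (1 / 2)"
        unfolding abs_mult abs_divide
        using v\<rho> \<rho>1 \<rho>2 k B H1[of x] by (intro frac_le mult_mono) auto
      also have "\<dots> = d\<^sup>2 * (16 * k\<^sup>2 * B\<^sup>2 * H x)"
        by (simp add: power2_eq_square)
      also have "\<bar>r x\<bar> + \<bar>LINT y|Q. r y\<bar> \<le> d\<^sup>2 * (k * H x + k * B)"
        using Er rem[OF d, of x] by (simp add: r_def algebra_simps)
      also have "\<dots> \<le> d\<^sup>2 * (2 * k * B * H x)"
        using kH by (intro mult_left_mono) auto
      also have "d\<^sup>2 * (16 * k\<^sup>2 * B\<^sup>2 * H x) + d\<^sup>2 * (2 * k * B * H x) = K * d\<^sup>2 * H x"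
        by (simp add: K_def algebra_simps)
      finally show ?thesis by (simp add: v_def \<rho>_def e_def)
    qed
  qed
  show ?thesis
    using \<epsilon>(1,2) K main(1) main(2)[where d = 0] unfolding H_def
    by (intro exI[of _ \<epsilon>] exI[of _ K]) simp
qed

definition exp_tilt :: "real measure \<Rightarrow> real \<Rightarrow> real measure" where
  "exp_tilt Q d = density Q (\<lambda>x. ennreal (exp (d * x) / (LINT y|Q. exp (d * y))))"

text \<open>
  Coordinates are divided into a set \<open>S\<close> with shifts at most \<open>\<epsilon>\<close> and a set \<open>B\<close> of at most
  \<open>b = \<delta>\<^sup>2 / \<epsilon>\<^sup>2\<close> others. For \<open>i\<close> in \<open>B\<close> the density \<open>f i\<close> is replaced by \<open>g i\<close>: the mass \<open>q i\<close>
  that it puts outside \<open>{-R..R}\<close> is removed and spread according to \<open>Q\<close>, so that \<open>g i\<close> is a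
  bounded density at \<open>L\<^sup>1\<close> distance at most \<open>2 * q i\<close> from \<open>f i\<close>. The radius \<open>R\<close> is fixed so
  that these distances add up to at most \<open>\<gamma> / 2\<close>; afterwards \<open>s\<close> and \<open>a\<close> are constants, and the
  comparison of the \<open>g i\<close> with \<open>Q\<close> has an error tending to 0 as \<open>n\<close> grows.
\<close>

lemma exponential_tilts_close_to_iid:
  fixes \<eta> C D \<delta> \<gamma> :: real
  assumes \<eta>: "\<eta> > 0" and C: "C \<ge> 1" and \<delta>: "\<delta> > 0" and \<gamma>: "\<gamma> > 0"
  shows "\<forall>\<^sub>F n in sequentially. \<forall>Q d. \<forall>T\<in>invariant_test_functions n.
    exp_moment_le \<eta> C Q \<longrightarrow> (\<Sum>i<n. d i) = 0 \<longrightarrow> (\<Sum>i<n. (d i)\<^sup>2) \<le> \<delta>\<^sup>2 \<longrightarrow>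
    (\<forall>i<n. \<bar>d i\<bar> \<le> D \<and> 1 \<le> C * (LINT x|Q. exp (d i * x)) \<and> exp_moment_le \<eta> C (exp_tilt Q (d i))) \<longrightarrow>
    \<bar>(LINT x|(\<Pi>\<^sub>M i\<in>{..<n}. exp_tilt Q (d i)). T x) - (LINT x|(\<Pi>\<^sub>M i\<in>{..<n}. Q). T x)\<bar> \<le> \<gamma>"
proof -
  obtain \<epsilon> K where \<epsilon>: "0 < \<epsilon>" "\<epsilon> \<le> 1" and K: "0 \<le> K"
    and expansion: "\<And>Q d x. exp_moment_le \<eta> C Q \<Longrightarrow> \<bar>d\<bar> \<le> \<epsilon> \<Longrightarrow>
      \<bar>exp (d * x) / (LINT y|Q. exp (d * y)) - 1 - d * (x - (LINT y|Q. y))\<bar> \<le>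
        K * d\<^sup>2 * exp (\<eta> / 2 * \<bar>x\<bar>)"
    and centred: "\<And>Q x. exp_moment_le \<eta> C Q \<Longrightarrow>
      \<bar>x - (LINT y|Q. y)\<bar> \<le> K * exp (\<eta> / 2 * \<bar>x\<bar>)"
    using exponential_tilt_expansion[OF \<eta>, of C] by metis
  define b where "b = \<delta>\<^sup>2 / \<epsilon>\<^sup>2"
  \<comment> \<open>Chosen so that \<open>exp (\<eta> * R) = 1 + 4 * C * b / \<gamma>\<close>; the summand 1 ensures \<open>R \<ge> 0\<close>.\<close>
  define R where "R = ln (1 + 4 * C * b / \<gamma>) / \<eta>"
  define c where "c = C * exp (D * R) + 1"
  define s where "s = 4 * K\<^sup>2 * C * \<delta>\<^sup>2 + b * c\<^sup>2"
  define a where "a = (K * (\<delta>\<^sup>2 / \<epsilon>) + K * \<delta>\<^sup>2 + b * c)\<^sup>2 * C"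
  have b: "b > 0" using \<delta> \<epsilon> by (simp add: b_def)
  have R: "R \<ge> 0" "b * (2 * (C * exp (- (\<eta> * R)))) \<le> \<gamma> / 2"
  proof -
    have pos: "4 * C * b / \<gamma> > 0" using C b \<gamma> by simp
    then show "R \<ge> 0" using \<eta> by (simp add: R_def)
    have "exp (- (\<eta> * R)) = 1 / (1 + 4 * C * b / \<gamma>)"
      using \<eta> pos by (simp add: R_def exp_minus inverse_eq_divide)
    also have "\<dots> \<le> 1 / (4 * C * b / \<gamma>)"
      using pos by (intro frac_le) auto
    finally have "2 * C * b * exp (- (\<eta> * R)) \<le> 2 * C * b * (1 / (4 * C * b / \<gamma>))"
      using C b by (intro mult_left_mono) auto
    also have "\<dots> = \<gamma> / 2"
    proof -
      have "C \<noteq> 0" "b \<noteq> 0" "\<gamma> \<noteq> 0" using C b \<gamma> by auto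
      then show ?thesis by simp
    qed
    finally show "b * (2 * (C * exp (- (\<eta> * R)))) \<le> \<gamma> / 2" by (simp add: mult_ac)
  qed
  have c: "c \<ge> 1" using C by (simp add: c_def)
  have "(\<lambda>n. sqrt (exp s * sqrt ((a\<^sup>2 + 2 * s\<^sup>2) / real n))) \<longlonglongrightarrow> sqrt (exp s * sqrt 0)"
    by (intro tendsto_intros tendsto_real_sqrt real_tendsto_divide_at_top[OF tendsto_const] filterlim_real_sequentially)
  then have "(\<lambda>n. sqrt (exp s * sqrt ((a\<^sup>2 + 2 * s\<^sup>2) / real n))) \<longlonglongrightarrow> 0" by simp
  then have "\<forall>\<^sub>F n in sequentially. sqrt (exp s * sqrt ((a\<^sup>2 + 2 * s\<^sup>2) / real n)) < \<gamma> / 2"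
    using \<gamma> by (intro order_tendstoD(2)) auto
  then show ?thesis
    using eventually_ge_at_top[of 2]
  proof (eventually_elim, intro allI ballI impI)
    fix n :: nat and Q :: "real measure" and d :: "nat \<Rightarrow> real" and T :: "(nat \<Rightarrow> real) \<Rightarrow> real"
    assume rate: "sqrt (exp s * sqrt ((a\<^sup>2 + 2 * s\<^sup>2) / real n)) < \<gamma> / 2" and n: "2 \<le> n"
      and T: "T \<in> invariant_test_functions n" and moment: "exp_moment_le \<eta> C Q"
      and d0: "(\<Sum>i<n. d i) = 0" and d2: "(\<Sum>i<n. (d i)\<^sup>2) \<le> \<delta>\<^sup>2"
      and tilts: "\<forall>i<n. \<bar>d i\<bar> \<le> D \<and> 1 \<le> C * (LINT x|Q. exp (d i * x)) \<and>
        exp_moment_le \<eta> C (exp_tilt Q (d i))"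
    have dD: "\<bar>d i\<bar> \<le> D" and norm_C: "1 \<le> C * (LINT x|Q. exp (d i * x))"
      and tilt: "exp_moment_le \<eta> C (exp_tilt Q (d i))" if "i < n" for i
      using tilts that by auto
    have Q: "prob_space Q" and sets[measurable_cong]: "sets Q = sets borel"
      and int: "integrable Q (\<lambda>x. exp (\<eta> * \<bar>x\<bar>))" and intC: "(LINT x|Q. exp (\<eta> * \<bar>x\<bar>)) \<le> C"
      using moment by (auto simp: exp_moment_le_def)
    have space: "space Q = space borel" by (rule sets_eq_imp_space_eq[OF sets])
    have T_meas: "T \<in> borel_measurable (\<Pi>\<^sub>M i\<in>{..<n}. Q)"
      and T_range: "\<And>x. x \<in> space (\<Pi>\<^sub>M i\<in>{..<n}. Q) \<Longrightarrow> T x \<in> {0..1}"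
      and T_inv: "\<And>p x. p permutes {..<n} \<Longrightarrow> x \<in> space (\<Pi>\<^sub>M i\<in>{..<n}. Q) \<Longrightarrow> T (x \<circ> p) = T x"
    proof -
      have "sets (\<Pi>\<^sub>M i\<in>{..<n}. Q) = sets (\<Pi>\<^sub>M i\<in>{..<n}. borel)"
        by (intro sets_PiM_cong refl sets)
      then show "T \<in> borel_measurable (\<Pi>\<^sub>M i\<in>{..<n}. Q)"
        using T measurable_cong_sets[of "\<Pi>\<^sub>M i\<in>{..<n}. Q" "\<Pi>\<^sub>M i\<in>{..<n}. borel" borel borel]
        by (auto simp: invariant_test_functions_def test_functions_def)
    qed (use T in \<open>auto simp: invariant_test_functions_def test_functions_def space_PiM space\<close>)
    interpret prob_space Q by fact
    define H where "H x = exp (\<eta> / 2 * \<bar>x\<bar>)" for x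
    define e where "e = (LINT y|Q. y)"
    define \<rho> where "\<rho> i = (LINT y|Q. exp (d i * y))" for i
    define f where "f i x = exp (d i * x) / \<rho> i" for i x
    define B where "B = {i. i < n \<and> \<epsilon> < \<bar>d i\<bar>}"
    define S where "S = {..<n} - B"
    define out where "out x = (indicator {x. R < \<bar>x\<bar>} x :: real)" for x
    define q where "q i = (LINT x|Q. f i x * out x)" for i
    define g where "g i x = (if i \<in> B then f i x * (1 - out x) + q i else f i x)" for i x
    have H1: "H x \<ge> 1" for x using \<eta> by (simp add: H_def)
    have H_sq: "(H x)\<^sup>2 = exp (\<eta> * \<bar>x\<bar>)" for x
      by (simp add: H_def power2_eq_square exp_add[symmetric])
    have B_sub: "B \<subseteq> {..<n}" by (auto simp: B_def)
    have S_small: "\<bar>d i\<bar> \<le> \<epsilon>" "i < n" "i \<notin> B" if "i \<in> S" for i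
      using that by (auto simp: S_def B_def)
    have split: "(\<Sum>i<n. u i) = (\<Sum>i\<in>S. u i) + (\<Sum>i\<in>B. u i)" for u :: "nat \<Rightarrow> real"
      unfolding S_def using B_sub by (simp add: sum.subset_diff)
    have S2: "(\<Sum>i\<in>S. (d i)\<^sup>2) \<le> \<delta>\<^sup>2" and B2: "(\<Sum>i\<in>B. (d i)\<^sup>2) \<le> \<delta>\<^sup>2"
      using d2 split[of "\<lambda>i. (d i)\<^sup>2"] sum_nonneg[of S "\<lambda>i. (d i)\<^sup>2"] sum_nonneg[of B "\<lambda>i. (d i)\<^sup>2"] by auto
    have cardB: "real (card B) \<le> b"
    proof -
      have "real (card B) * \<epsilon>\<^sup>2 = (\<Sum>i\<in>B. \<epsilon>\<^sup>2)" by simp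
      also have "\<dots> \<le> (\<Sum>i\<in>B. (d i)\<^sup>2)"
        using \<epsilon> by (intro sum_mono) (auto simp: B_def abs_le_square_iff[symmetric])
      finally show ?thesis using B2 \<epsilon> by (simp add: b_def field_simps)
    qed
    \<comment> \<open>The small shifts need not sum to zero, but their sum is minus the sum of the boundedly many
      large ones.\<close>
    have dS: "\<bar>\<Sum>i\<in>S. d i\<bar> \<le> \<delta>\<^sup>2 / \<epsilon>"
    proof -
      have "\<bar>\<Sum>i\<in>S. d i\<bar> = \<bar>\<Sum>i\<in>B. d i\<bar>" using d0 split[of d] by linarith
      also have "\<dots> \<le> (\<Sum>i\<in>B. \<bar>d i\<bar>)" by (rule sum_abs)
      also have "\<dots> \<le> (\<Sum>i\<in>B. (d i)\<^sup>2 / \<epsilon>)"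
      proof (rule sum_mono)
        fix i assume "i \<in> B"
        then have "\<bar>d i\<bar> * \<epsilon> \<le> \<bar>d i\<bar> * \<bar>d i\<bar>" by (intro mult_left_mono) (auto simp: B_def)
        then show "\<bar>d i\<bar> \<le> (d i)\<^sup>2 / \<epsilon>" using \<epsilon> by (simp add: field_simps power2_eq_square)
      qed
      also have "\<dots> \<le> \<delta>\<^sup>2 / \<epsilon>"
        unfolding sum_divide_distrib[symmetric] using B2 \<epsilon> by (intro divide_right_mono) auto
      finally show ?thesis .
    qed
    have \<rho>: "\<rho> i > 0" "1 / \<rho> i \<le> C" if "i < n" for i
    proof -
      show "\<rho> i > 0" using norm_C[OF that] C unfolding \<rho>_def
        by (smt (verit) mult_nonneg_nonpos)
      then show "1 / \<rho> i \<le> C" using norm_C[OF that] unfolding \<rho>_def[symmetric] by (simp add: field_simps)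
    qed
    have exp_int: "integrable Q (\<lambda>x. exp (d i * x))" if "i < n" for i
      \<comment> \<open>A function that is not integrable has Bochner integral 0.\<close>
      using \<rho>(1)[OF that] not_integrable_integral_eq[of Q "\<lambda>x. exp (d i * x)"] by (auto simp: \<rho>_def)
    have f_meas[measurable]: "f i \<in> borel_measurable Q" for i
      unfolding f_def[abs_def] by measurable
    have out_meas[measurable]: "out \<in> borel_measurable Q"
      unfolding out_def[abs_def] by measurable
    have out01: "0 \<le> out x" "out x \<le> 1" for x by (auto simp: out_def)
    have f_pos: "f i x > 0" if "i < n" for i x using \<rho>(1)[OF that] by (simp add: f_def)
    have f_int: "integrable Q (f i)" "(LINT x|Q. f i x) = 1" if "i < n" for i
      using exp_int[OF that] \<rho>(1)[OF that] by (simp_all add: f_def[abs_def] \<rho>_def[symmetric])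
    have tilt_eq: "exp_tilt Q (d i) = density Q (\<lambda>x. ennreal (f i x))" for i
      by (simp add: exp_tilt_def f_def \<rho>_def)
    have f_exp: "integrable Q (\<lambda>x. f i x * exp (\<eta> * \<bar>x\<bar>))" "(LINT x|Q. f i x * exp (\<eta> * \<bar>x\<bar>)) \<le> C"
      if "i < n" for i
      using tilt[OF that] f_pos[OF that]
      by (simp_all add: exp_moment_le_def tilt_eq integrable_density integral_density less_imp_le)
    have f_times: "integrable Q (\<lambda>x. f i x * w x)" if "i < n" "w \<in> borel_measurable Q" "\<And>x. 0 \<le> w x \<and> w x \<le> 1" for i w
      by (rule Bochner_Integration.integrable_bound[OF f_int(1)[OF that(1)]])
        (use that f_pos[OF that(1)] in \<open>auto intro!: AE_I2 mult_left_le simp: abs_mult\<close>)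
    have q: "0 \<le> q i" "q i \<le> 1" "q i \<le> C * exp (- (\<eta> * R))" if i: "i < n" for i
    proof -
      have fo: "integrable Q (\<lambda>x. f i x * out x)" by (rule f_times[OF i]) (auto simp: out01)
      show "0 \<le> q i"
        unfolding q_def using f_pos[OF i] out01 by (intro Bochner_Integration.integral_nonneg) (auto simp: less_imp_le)
      have "q i \<le> (LINT x|Q. f i x)"
        unfolding q_def using fo f_int(1)[OF i] f_pos[OF i] out01
        by (intro integral_mono) (auto intro!: mult_left_le simp: less_imp_le)
      then show "q i \<le> 1" using f_int(2)[OF i] by simp
      have "q i \<le> (LINT x|Q. exp (- (\<eta> * R)) * (f i x * exp (\<eta> * \<bar>x\<bar>)))"
        unfolding q_def
      proof (rule integral_mono[OF fo])
        show "integrable Q (\<lambda>x. exp (- (\<eta> * R)) * (f i x * exp (\<eta> * \<bar>x\<bar>)))"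
          by (intro integrable_mult_right f_exp(1)[OF i])
        fix x
        have "out x \<le> exp (- (\<eta> * R)) * exp (\<eta> * \<bar>x\<bar>)"
          using \<eta> by (auto simp: out_def indicator_def exp_add[symmetric])
        then have "f i x * out x \<le> f i x * (exp (- (\<eta> * R)) * exp (\<eta> * \<bar>x\<bar>))"
          using f_pos[OF i] by (intro mult_left_mono) (auto simp: less_imp_le)
        then show "f i x * out x \<le> exp (- (\<eta> * R)) * (f i x * exp (\<eta> * \<bar>x\<bar>))"
          by (simp add: mult_ac)
      qed
      also have "\<dots> \<le> C * exp (- (\<eta> * R))"
        using f_exp(2)[OF i] by (simp add: mult.commute)
      finally show "q i \<le> C * exp (- (\<eta> * R))" .
    qed
    have in_f: "integrable Q (\<lambda>x. f i x * (1 - out x))" "integrable Q (\<lambda>x. f i x * out x)" if "i < n" for i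
      by (rule f_times[OF that]; auto simp: out01)+
    have g_int: "integrable Q (g i)" and g_one: "(LINT x|Q. g i x) = 1" if i: "i < n" for i
    proof -
      show "integrable Q (g i)"
        using in_f(1)[OF i] f_int(1)[OF i] by (cases "i \<in> B") (simp_all add: g_def[abs_def])
      have "(LINT x|Q. f i x * (1 - out x) + q i) = (LINT x|Q. f i x * (1 - out x)) + q i"
        using in_f(1)[OF i] by (simp add: prob_space)
      also have "\<dots> = (LINT x|Q. f i x * (1 - out x) + f i x * out x)"
        using in_f[OF i] by (simp add: q_def)
      also have "\<dots> = 1" using f_int(2)[OF i] by (simp add: algebra_simps)
      finally show "(LINT x|Q. g i x) = 1"
        using f_int(2)[OF i] by (cases "i \<in> B") (simp_all add: g_def)
    qed
    have g_nonneg: "0 \<le> g i x" if "i < n" for i x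
      using f_pos[OF that, of x] q(1)[OF that] out01[of x] by (simp add: g_def)
    have B_bound: "\<bar>g i x - 1\<bar> \<le> c" if "i \<in> B" for i x
    proof -
      have i: "i < n" using that B_sub by auto
      have "f i x * (1 - out x) \<le> C * exp (D * R)"
      proof (cases "R < \<bar>x\<bar>")
        case True
        then show ?thesis using C by (simp add: out_def)
      next
        case False
        have "d i * x \<le> \<bar>d i\<bar> * \<bar>x\<bar>" by (simp add: abs_mult[symmetric])
        also have "\<dots> \<le> D * R"
          using False dD[OF i] by (intro mult_mono) auto
        finally have "exp (d i * x) * (1 / \<rho> i) \<le> exp (D * R) * C"
          using \<rho>[OF i] by (intro mult_mono) auto
        then show ?thesis using False by (simp add: out_def f_def mult.commute)
      qed
      then have "g i x \<le> c"
        using q(2)[OF i] that by (simp add: g_def c_def)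
      then show ?thesis
        using g_nonneg[OF i, of x] c by linarith
    qed
    have expand: "\<bar>f i x - 1 - d i * (x - e)\<bar> \<le> K * (d i)\<^sup>2 * H x" if "i \<in> S" for i x
      unfolding f_def \<rho>_def e_def H_def by (rule expansion[OF moment S_small(1)[OF that]])
    have xe: "\<bar>x - e\<bar> \<le> K * H x" for x
      unfolding e_def H_def by (rule centred[OF moment])
    have S_bound: "\<bar>g i x - 1\<bar> \<le> 2 * K * \<bar>d i\<bar> * H x" if "i \<in> S" for i x
    proof -
      have "\<bar>f i x - 1\<bar> \<le> \<bar>d i\<bar> * \<bar>x - e\<bar> + K * (d i)\<^sup>2 * H x"
        using expand[OF that, of x] abs_mult[of "d i" "x - e"] by linarith
      also have "\<dots> \<le> \<bar>d i\<bar> * (K * H x) + \<bar>d i\<bar> * (K * H x)"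
      proof (rule add_mono)
        show "\<bar>d i\<bar> * \<bar>x - e\<bar> \<le> \<bar>d i\<bar> * (K * H x)" using xe by (intro mult_left_mono) auto
        have "(d i)\<^sup>2 \<le> \<bar>d i\<bar>"
          using S_small(1)[OF that] \<epsilon>(2) mult_left_le[of "\<bar>d i\<bar>" "\<bar>d i\<bar>"] by (simp add: power2_eq_square)
        then have "(d i)\<^sup>2 * (K * H x) \<le> \<bar>d i\<bar> * (K * H x)"
          using K H1[of x] by (intro mult_right_mono) auto
        then show "K * (d i)\<^sup>2 * H x \<le> \<bar>d i\<bar> * (K * H x)" by (simp add: mult_ac)
      qed
      finally show ?thesis using S_small[OF that] by (simp add: g_def mult_ac)
    qed
    have g_meas[measurable]: "g i \<in> borel_measurable Q" for i
      unfolding g_def[abs_def] by measurable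
    have dominated_sq: "integrable Q (\<lambda>x. (u x)\<^sup>2)" "(LINT x|Q. (u x)\<^sup>2) \<le> w\<^sup>2 * C"
      if u: "u \<in> borel_measurable Q" "\<And>x. \<bar>u x\<bar> \<le> w * H x" for u w
    proof -
      have le: "(u x)\<^sup>2 \<le> w\<^sup>2 * exp (\<eta> * \<bar>x\<bar>)" for x
        using power_mono[OF u(2)[of x], of 2] by (simp add: power_mult_distrib H_sq)
      show i2: "integrable Q (\<lambda>x. (u x)\<^sup>2)"
        by (rule Bochner_Integration.integrable_bound[where f = "\<lambda>x. w\<^sup>2 * exp (\<eta> * \<bar>x\<bar>)"])
          (use u le int in \<open>auto intro!: AE_I2\<close>)
      have "(LINT x|Q. (u x)\<^sup>2) \<le> (LINT x|Q. w\<^sup>2 * exp (\<eta> * \<bar>x\<bar>))"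
        using int i2 le by (intro integral_mono) auto
      also have "\<dots> \<le> w\<^sup>2 * C" using intC by (simp add: mult_left_mono)
      finally show "(LINT x|Q. (u x)\<^sup>2) \<le> w\<^sup>2 * C" .
    qed
    have h2: "integrable Q (\<lambda>x. (g i x - 1)\<^sup>2)" if "i < n" for i
    proof (cases "i \<in> B")
      case True
      then show ?thesis
        using order_trans[OF B_bound[OF True]] mult_left_mono[OF H1, of c] c
        by (intro dominated_sq(1)[of "\<lambda>x. g i x - 1" c]) auto
    next
      case False
      then show ?thesis
        using S_bound[of i] that by (intro dominated_sq(1)[of "\<lambda>x. g i x - 1" "2 * K * \<bar>d i\<bar>"]) (auto simp: S_def)
    qed
    have sum_h2: "(\<Sum>i<n. LINT x|Q. (g i x - 1)\<^sup>2) \<le> s"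
    proof -
      have "(\<Sum>i\<in>S. LINT x|Q. (g i x - 1)\<^sup>2) \<le> (\<Sum>i\<in>S. (2 * K * \<bar>d i\<bar>)\<^sup>2 * C)"
        using S_bound by (intro sum_mono dominated_sq(2)) auto
      also have "\<dots> = 4 * K\<^sup>2 * C * (\<Sum>i\<in>S. (d i)\<^sup>2)"
        by (simp add: power_mult_distrib sum_distrib_left mult_ac)
      also have "\<dots> \<le> 4 * K\<^sup>2 * C * \<delta>\<^sup>2"
        using S2 C by (intro mult_left_mono) auto
      finally have 1: "(\<Sum>i\<in>S. LINT x|Q. (g i x - 1)\<^sup>2) \<le> 4 * K\<^sup>2 * C * \<delta>\<^sup>2" .
      have "(\<Sum>i\<in>B. LINT x|Q. (g i x - 1)\<^sup>2) \<le> (\<Sum>i\<in>B. c\<^sup>2)"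
      proof (rule sum_mono)
        fix i assume i: "i \<in> B"
        then have "(LINT x|Q. (g i x - 1)\<^sup>2) \<le> (LINT x|Q. c\<^sup>2)"
          using B_bound[OF i] h2[of i] B_sub c
          by (intro integral_mono) (auto simp: abs_le_square_iff[symmetric])
        then show "(LINT x|Q. (g i x - 1)\<^sup>2) \<le> c\<^sup>2" by (simp add: prob_space)
      qed
      also have "\<dots> \<le> b * c\<^sup>2" using cardB by (simp add: mult_right_mono)
      finally show ?thesis using 1 by (simp add: split s_def)
    qed
    have sum_h: "(LINT x|Q. (\<Sum>i<n. g i x - 1)\<^sup>2) \<le> a"
      unfolding a_def
    proof (rule dominated_sq(2))
      fix x
      have "\<bar>\<Sum>i\<in>S. f i x - 1\<bar> \<le> \<bar>\<Sum>i\<in>S. d i * (x - e)\<bar> + \<bar>\<Sum>i\<in>S. f i x - 1 - d i * (x - e)\<bar>"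
        by (simp add: sum_subtractf)
      also have "\<bar>\<Sum>i\<in>S. d i * (x - e)\<bar> \<le> (\<delta>\<^sup>2 / \<epsilon>) * (K * H x)"
        unfolding sum_distrib_right[symmetric] abs_mult using dS xe by (intro mult_mono) auto
      also have "\<bar>\<Sum>i\<in>S. f i x - 1 - d i * (x - e)\<bar> \<le> (\<Sum>i\<in>S. K * (d i)\<^sup>2 * H x)"
        using expand by (intro order_trans[OF sum_abs] sum_mono) auto
      also have "\<dots> = K * H x * (\<Sum>i\<in>S. (d i)\<^sup>2)"
        by (simp add: sum_distrib_left mult_ac)
      also have "\<dots> \<le> K * H x * \<delta>\<^sup>2"
        using S2 K H1[of x] by (intro mult_left_mono) auto
      finally have 1: "\<bar>\<Sum>i\<in>S. f i x - 1\<bar> \<le> \<delta>\<^sup>2 / \<epsilon> * (K * H x) + K * H x * \<delta>\<^sup>2" by simp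
      have "\<bar>\<Sum>i\<in>B. g i x - 1\<bar> \<le> (\<Sum>i\<in>B. c)"
        using B_bound by (intro order_trans[OF sum_abs] sum_mono) auto
      also have "\<dots> \<le> b * c" using cardB c by (simp add: mult_right_mono)
      also have "\<dots> \<le> b * c * H x" using b c mult_left_mono[OF H1[of x], of "b * c"] by simp
      finally have 2: "\<bar>\<Sum>i\<in>B. g i x - 1\<bar> \<le> b * c * H x" .
      have "(\<Sum>i\<in>S. g i x - 1) = (\<Sum>i\<in>S. f i x - 1)"
        using S_small(3) by (intro sum.cong) (auto simp: g_def)
      then have "\<bar>\<Sum>i<n. g i x - 1\<bar> \<le> \<delta>\<^sup>2 / \<epsilon> * (K * H x) + K * H x * \<delta>\<^sup>2 + b * c * H x"
        using 1 2 unfolding split by linarith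
      then show "\<bar>\<Sum>i<n. g i x - 1\<bar> \<le> (K * (\<delta>\<^sup>2 / \<epsilon>) + K * \<delta>\<^sup>2 + b * c) * H x"
        by (simp add: algebra_simps)
    qed measurable
    have main: "\<bar>(LINT x|(\<Pi>\<^sub>M i\<in>{..<n}. density Q (\<lambda>x. ennreal (g i x))). T x) - (LINT x|(\<Pi>\<^sub>M i\<in>{..<n}. Q). T x)\<bar>
        \<le> sqrt (exp s * sqrt ((a\<^sup>2 + 2 * s\<^sup>2) / card {..<n}))"
      using n by (intro permutation_mixture_close_to_iid Q T_meas T_range T_inv)
        (auto simp: g_nonneg g_one h2 sum_h2 sum_h)
    have L1: "(LINT x|Q. \<bar>f i x - g i x\<bar>) \<le> 2 * (C * exp (- (\<eta> * R)))" if "i \<in> B" for i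
    proof -
      have i: "i < n" using that B_sub by auto
      have diff: "\<bar>f i x - g i x\<bar> \<le> f i x * out x + q i" for x
      proof -
        have "f i x - g i x = f i x * out x - q i" using that by (simp add: g_def algebra_simps)
        moreover have "f i x * out x \<ge> 0" using f_pos[OF i, of x] out01[of x] by simp
        ultimately show ?thesis using q(1)[OF i] by linarith
      qed
      have "(LINT x|Q. \<bar>f i x - g i x\<bar>) \<le> (LINT x|Q. f i x * out x + q i)"
        using f_int(1)[OF i] g_int[OF i] in_f(2)[OF i] diff by (intro integral_mono) auto
      also have "\<dots> = 2 * q i" using in_f(2)[OF i] by (simp add: q_def[symmetric] prob_space)
      finally show ?thesis using q(3)[OF i] by linarith
    qed
    have "\<bar>(LINT x|(\<Pi>\<^sub>M i\<in>{..<n}. density Q (\<lambda>x. ennreal (f i x))). T x)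
        - (LINT x|(\<Pi>\<^sub>M i\<in>{..<n}. density Q (\<lambda>x. ennreal (g i x))). T x)\<bar>
        \<le> (\<Sum>i<n. LINT x|Q. \<bar>f i x - g i x\<bar>)"
      by (intro PiM_density_L1_perturbation Q T_meas T_range)
        (auto simp: f_int g_int g_one g_nonneg f_pos less_imp_le)
    also have "\<dots> = (\<Sum>i\<in>B. LINT x|Q. \<bar>f i x - g i x\<bar>)"
      using S_small(3) by (simp add: split g_def)
    also have "\<dots> \<le> (\<Sum>i\<in>B. 2 * (C * exp (- (\<eta> * R))))"
      by (intro sum_mono L1)
    also have "\<dots> \<le> b * (2 * (C * exp (- (\<eta> * R))))"
      using cardB C by (simp add: mult_right_mono)
    also have "\<dots> \<le> \<gamma> / 2" by (rule R(2))
    finally have "\<bar>(LINT x|(\<Pi>\<^sub>M i\<in>{..<n}. density Q (\<lambda>x. ennreal (f i x))). T x)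
        - (LINT x|(\<Pi>\<^sub>M i\<in>{..<n}. Q). T x)\<bar> \<le> \<gamma>"
      using main rate unfolding card_lessThan by linarith
    then show "\<bar>(LINT x|(\<Pi>\<^sub>M i\<in>{..<n}. exp_tilt Q (d i)). T x) - (LINT x|(\<Pi>\<^sub>M i\<in>{..<n}. Q). T x)\<bar> \<le> \<gamma>"
      by (simp add: tilt_eq)
  qed
qed

section \<open>Exponential families\<close>

text \<open>
  Whatever the value of \<open>log_partition\<close>, total mass 1 makes a positive multiple of the integral of
  \<open>exp (\<theta> * x)\<close> equal to 1, so that this integral is finite and \<open>\<mu>\<close> does not vanish.
\<close>

lemma prob_space_exp_family_imp:
  assumes sets[measurable_cong]: "sets \<mu> = sets borel" and P: "prob_space (exp_family \<mu> \<theta>)"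
  shows "integrable \<mu> (\<lambda>x. exp (\<theta> * x))" and "emeasure \<mu> (space \<mu>) \<noteq> 0"
proof -
  let ?g = "\<lambda>x. exp (\<theta> * x - log_partition \<mu> \<theta>)"
  have 1: "(\<integral>\<^sup>+x. ennreal (?g x) \<partial>\<mu>) = 1"
    using prob_space.emeasure_space_1[OF P] by (simp add: exp_family_def emeasure_density cong: nn_integral_cong)
  then have "integrable \<mu> ?g"
    by (intro integrableI_bounded) auto
  then have "integrable \<mu> (\<lambda>x. exp (log_partition \<mu> \<theta>) * ?g x)"
    by (rule integrable_mult_right)
  then show "integrable \<mu> (\<lambda>x. exp (\<theta> * x))"
    by (simp add: exp_add[symmetric])
  show "emeasure \<mu> (space \<mu>) \<noteq> 0"
  proof
    assume "emeasure \<mu> (space \<mu>) = 0"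
    then have "AE x in \<mu>. False" by (intro AE_I[of _ _ "space \<mu>"]) auto
    then have "(\<integral>\<^sup>+x. ennreal (?g x) \<partial>\<mu>) = (\<integral>\<^sup>+x. 0 \<partial>\<mu>)"
      by (intro nn_integral_cong_AE) auto
    with 1 show False by simp
  qed
qed

text \<open>
  Uniformity over the parameter interval: for \<open>\<theta>\<close> between \<open>l\<close> and \<open>u\<close> the function \<open>exp (\<theta> * x)\<close> is
  at least the minimum \<open>v x\<close> of its values at the endpoints and, even after multiplication by
  \<open>exp (\<eta> * \<bar>x\<bar>)\<close>, at most the sum \<open>w x\<close> of its values at \<open>l - \<eta>\<close> and \<open>u + \<eta>\<close>. Neither bound
  depends on \<open>\<theta>\<close>, so \<open>C\<close> can be the ratio of the integrals of \<open>w\<close> and \<open>v\<close>. Integrability is assumed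
  only at the two enlarged endpoints because the mean of the parameters, which lies in the interval,
  may fall into a gap of the parameter set.
\<close>

lemma exp_family_on_interval:
  fixes \<mu> :: "real measure" and l u \<eta> :: real
  assumes sets[measurable_cong]: "sets \<mu> = sets borel" and \<mu>: "emeasure \<mu> (space \<mu>) \<noteq> 0"
    and \<eta>: "\<eta> > 0" and lu: "l \<le> u"
    and int_l: "integrable \<mu> (\<lambda>x. exp ((l - \<eta>) * x))" and int_u: "integrable \<mu> (\<lambda>x. exp ((u + \<eta>) * x))"
  shows "\<exists>C\<ge>1. \<forall>\<theta>\<in>{l..u}. exp_moment_le \<eta> C (exp_family \<mu> \<theta>) \<and>
    (\<forall>\<theta>'\<in>{l..u}. exp_family \<mu> \<theta>' = exp_tilt (exp_family \<mu> \<theta>) (\<theta>' - \<theta>) \<and>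
      1 \<le> C * (LINT x|exp_family \<mu> \<theta>. exp ((\<theta>' - \<theta>) * x)))"
proof -
  define w where "w x = exp ((l - \<eta>) * x) + exp ((u + \<eta>) * x)" for x
  define v where "v x = min (exp (l * x)) (exp (u * x))" for x :: real
  define M where "M \<theta> = (LINT x|\<mu>. exp (\<theta> * x))" for \<theta>
  define W where "W = (LINT x|\<mu>. w x)"
  define M0 where "M0 = (LINT x|\<mu>. v x)"
  have w_int: "integrable \<mu> w" unfolding w_def[abs_def] using int_l int_u by simp
  have le_w: "exp (\<theta> * x) * exp (\<eta> * \<bar>x\<bar>) \<le> w x" if "\<theta> \<in> {l..u}" for \<theta> x
  proof (cases "x \<ge> 0")
    case True
    then have "\<theta> * x + \<eta> * \<bar>x\<bar> \<le> (u + \<eta>) * x"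
      using that mult_right_mono[of \<theta> u x] by (simp add: algebra_simps)
    then have "exp (\<theta> * x + \<eta> * \<bar>x\<bar>) \<le> exp ((u + \<eta>) * x)" by simp
    then show ?thesis by (simp add: w_def exp_add add_increasing)
  next
    case False
    then have "\<theta> * x + \<eta> * \<bar>x\<bar> \<le> (l - \<eta>) * x"
      using that mult_right_mono_neg[of l \<theta> x] by (simp add: algebra_simps)
    then have "exp (\<theta> * x + \<eta> * \<bar>x\<bar>) \<le> exp ((l - \<eta>) * x)" by simp
    then show ?thesis by (simp add: w_def exp_add add_increasing2)
  qed
  have exp_le: "exp (\<theta> * x) \<le> exp (\<theta> * x) * exp (\<eta> * \<bar>x\<bar>)" for \<theta> x :: real
    using \<eta> by simp
  have int: "integrable \<mu> (\<lambda>x. exp (\<theta> * x) * exp (\<eta> * \<bar>x\<bar>))" "integrable \<mu> (\<lambda>x. exp (\<theta> * x))"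
    if "\<theta> \<in> {l..u}" for \<theta>
    using le_w[OF that] order_trans[OF exp_le le_w[OF that]]
    by (auto intro!: Bochner_Integration.integrable_bound[OF w_int] AE_I2 order_trans[OF _ abs_ge_self])
  have v_le: "v x \<le> exp (\<theta> * x)" if "\<theta> \<in> {l..u}" for \<theta> x
  proof (cases "x \<ge> 0")
    case True
    then show ?thesis using that mult_right_mono[of l \<theta> x] by (auto simp: v_def min_le_iff_disj)
  next
    case False
    then show ?thesis using that mult_right_mono_neg[of \<theta> u x] by (auto simp: v_def min_le_iff_disj)
  qed
  have v_pos: "v x > 0" for x by (simp add: v_def)
  have v_int: "integrable \<mu> v"
    by (rule Bochner_Integration.integrable_bound[OF int(2)[of l]])
      (use lu v_le[of l] v_pos in \<open>auto simp: less_imp_le v_def[abs_def] intro!: AE_I2\<close>)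
  have "M0 > 0"
  proof -
    have "M0 \<noteq> 0"
    proof
      assume "M0 = 0"
      then have "AE x in \<mu>. v x = 0"
        unfolding M0_def using v_int v_pos
        by (subst (asm) integral_nonneg_eq_0_iff_AE) (auto simp: less_imp_le)
      then have "AE x in \<mu>. False" using v_pos by (simp add: less_imp_neq[symmetric])
      with \<mu> show False by (simp add: eventually_False ae_filter_eq_bot_iff)
    qed
    moreover have "M0 \<ge> 0" unfolding M0_def using v_pos by (simp add: less_imp_le)
    ultimately show ?thesis by simp
  qed
  have M_ge: "M0 \<le> M \<theta>" if "\<theta> \<in> {l..u}" for \<theta>
    unfolding M0_def M_def by (intro integral_mono v_int int that v_le)
  have M_pos: "M \<theta> > 0" if "\<theta> \<in> {l..u}" for \<theta>
    using M_ge[OF that] \<open>M0 > 0\<close> by linarith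
  have W_ge: "(LINT x|\<mu>. exp (\<theta> * x) * exp (\<eta> * \<bar>x\<bar>)) \<le> W" "M \<theta> \<le> W" if "\<theta> \<in> {l..u}" for \<theta>
  proof -
    show 1: "(LINT x|\<mu>. exp (\<theta> * x) * exp (\<eta> * \<bar>x\<bar>)) \<le> W"
      unfolding W_def by (intro integral_mono w_int int that le_w)
    have "M \<theta> \<le> (LINT x|\<mu>. exp (\<theta> * x) * exp (\<eta> * \<bar>x\<bar>))"
      unfolding M_def by (intro integral_mono int that exp_le)
    with 1 show "M \<theta> \<le> W" by linarith
  qed
  define C where "C = W / M0"
  have C1: "C \<ge> 1"
    using M_ge[of l] W_ge(2)[of l] lu \<open>M0 > 0\<close> by (simp add: C_def)
  have family: "exp_family \<mu> \<theta> = density \<mu> (\<lambda>x. ennreal (exp (\<theta> * x) / M \<theta>))" if "\<theta> \<in> {l..u}" for \<theta>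
    using M_pos[OF that] by (simp add: exp_family_def log_partition_def M_def[symmetric] exp_diff)
  have integral_family: "(LINT x|exp_family \<mu> \<theta>. g x) = (LINT x|\<mu>. exp (\<theta> * x) * g x) / M \<theta>"
    and integrable_family: "integrable \<mu> (\<lambda>x. exp (\<theta> * x) * g x) \<Longrightarrow> integrable (exp_family \<mu> \<theta>) g"
    if "\<theta> \<in> {l..u}" "g \<in> borel_measurable \<mu>" for \<theta> and g :: "real \<Rightarrow> real"
  proof -
    have eq: "(exp (\<theta> * x) / M \<theta>) *\<^sub>R g x = exp (\<theta> * x) * g x / M \<theta>" for x
      by simp
    have nonneg: "AE x in \<mu>. 0 \<le> exp (\<theta> * x) / M \<theta>" and meas: "(\<lambda>x. exp (\<theta> * x) / M \<theta>) \<in> borel_measurable \<mu>"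
      using M_pos[OF that(1)] by (auto simp: less_imp_le)
    show "(LINT x|exp_family \<mu> \<theta>. g x) = (LINT x|\<mu>. exp (\<theta> * x) * g x) / M \<theta>"
      unfolding family[OF that(1)] integral_density[OF that(2) meas nonneg] eq by simp
    show "integrable (exp_family \<mu> \<theta>) g" if "integrable \<mu> (\<lambda>x. exp (\<theta> * x) * g x)"
      unfolding family[OF \<open>\<theta> \<in> {l..u}\<close>] integrable_density[OF \<open>g \<in> borel_measurable \<mu>\<close> meas nonneg] eq
      using that by simp
  qed
  show ?thesis
  proof (intro exI[of _ C] conjI ballI C1)
    fix \<theta> assume \<theta>: "\<theta> \<in> {l..u}"
    have "emeasure (exp_family \<mu> \<theta>) (space (exp_family \<mu> \<theta>)) = (\<integral>\<^sup>+x. ennreal (exp (\<theta> * x) / M \<theta>) \<partial>\<mu>)"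
      by (simp add: family[OF \<theta>] emeasure_density cong: nn_integral_cong)
    also have "\<dots> = ennreal (LINT x|\<mu>. exp (\<theta> * x) / M \<theta>)"
      using int(2)[OF \<theta>] M_pos[OF \<theta>] by (intro nn_integral_eq_integral) (auto simp: less_imp_le)
    also have "\<dots> = 1" using M_pos[OF \<theta>] by (simp add: M_def)
    finally have prob: "prob_space (exp_family \<mu> \<theta>)" by (rule prob_spaceI)
    have "(LINT x|exp_family \<mu> \<theta>. exp (\<eta> * \<bar>x\<bar>)) \<le> C"
      unfolding C_def using integral_family[OF \<theta>, of "\<lambda>x. exp (\<eta> * \<bar>x\<bar>)"]
        W_ge(1)[OF \<theta>] M_ge[OF \<theta>] \<open>M0 > 0\<close> W_ge(2)[OF \<theta>] M_pos[OF \<theta>]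
      by (auto intro!: frac_le)
    then show "exp_moment_le \<eta> C (exp_family \<mu> \<theta>)"
      using prob integrable_family[OF \<theta> _ int(1)[OF \<theta>]]
      by (auto simp: exp_moment_le_def exp_family_def sets)
    fix \<theta>' assume \<theta>': "\<theta>' \<in> {l..u}"
    have \<rho>: "(LINT x|exp_family \<mu> \<theta>. exp ((\<theta>' - \<theta>) * x)) = M \<theta>' / M \<theta>"
      using integral_family[OF \<theta>, of "\<lambda>x. exp ((\<theta>' - \<theta>) * x)"]
      by (simp add: M_def exp_add[symmetric] algebra_simps)
    have "M \<theta> \<le> C * M0" using W_ge(2)[OF \<theta>] \<open>M0 > 0\<close> by (simp add: C_def)
    also have "\<dots> \<le> C * M \<theta>'" using M_ge[OF \<theta>'] C1 by (intro mult_left_mono) auto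
    finally show "1 \<le> C * (LINT x|exp_family \<mu> \<theta>. exp ((\<theta>' - \<theta>) * x))"
      using M_pos[OF \<theta>] by (simp add: \<rho>)
    have "exp (\<theta>' * x) / M \<theta>' = exp (\<theta> * x) / M \<theta> * (exp ((\<theta>' - \<theta>) * x) / (M \<theta>' / M \<theta>))" for x
    proof -
      have "exp (\<theta>' * x) = exp (\<theta> * x) * exp ((\<theta>' - \<theta>) * x)"
        by (simp add: exp_add[symmetric] algebra_simps)
      then show ?thesis using M_pos[OF \<theta>] by simp
    qed
    then show "exp_family \<mu> \<theta>' = exp_tilt (exp_family \<mu> \<theta>) (\<theta>' - \<theta>)"
      unfolding exp_tilt_def \<rho> unfolding family[OF \<theta>] family[OF \<theta>']
      using M_pos[OF \<theta>] M_pos[OF \<theta>']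
      by (subst density_density_eq) (auto simp: ennreal_mult[symmetric] less_imp_le)
  qed
qed

text \<open>
  The mean of the parameters lies between the least and the greatest element of \<open>\<Theta>\<^sub>0\<close>, and the
  law at each coordinate is the tilt, by its deviation from the mean, of the law at the mean.
\<close>

theorem theorem2:
  fixes \<mu> :: "real measure" and \<Theta> \<Theta>\<^sub>0 :: "real set" and \<delta> :: real
  assumes "sets \<mu> = sets borel"
    and "open \<Theta>"
    and "\<And>\<theta>. \<theta> \<in> \<Theta> \<Longrightarrow> prob_space (exp_family \<mu> \<theta>)"
    and "compact \<Theta>\<^sub>0" and "\<Theta>\<^sub>0 \<subseteq> \<Theta>"
    and "\<delta> > 0"
  shows "(\<lambda>n. SUP (m, T) \<in> {(m, T). T \<in> invariant_test_functions n
                 \<and> L2_set (\<lambda>i. m i - vec_mean n m) {..<n} \<le> \<delta>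
                 \<and> (\<forall>i<n. m i \<in> \<Theta>\<^sub>0)}.
            ennreal \<bar>(LINT x|joint_law \<mu> n m. T x)
                     - (LINT x|joint_law \<mu> n (\<lambda>_. vec_mean n m). T x)\<bar>)
         \<longlonglongrightarrow> 0" (is "(\<lambda>n. ?S n) \<longlonglongrightarrow> 0")
proof -
  have bound: "\<forall>\<^sub>F n in sequentially. \<forall>m T. T \<in> invariant_test_functions n
      \<and> L2_set (\<lambda>i. m i - vec_mean n m) {..<n} \<le> \<delta> \<and> (\<forall>i<n. m i \<in> \<Theta>\<^sub>0) \<longrightarrow>
      \<bar>(LINT x|joint_law \<mu> n m. T x) - (LINT x|joint_law \<mu> n (\<lambda>_. vec_mean n m). T x)\<bar> \<le> \<gamma>"
    if \<gamma>: "\<gamma> > 0" for \<gamma>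
  proof (cases "\<Theta>\<^sub>0 = {}")
    case True
    show ?thesis
      using eventually_ge_at_top[of 1] by eventually_elim (use True in auto)
  next
    case False
    define l where "l = Inf \<Theta>\<^sub>0"
    define u where "u = Sup \<Theta>\<^sub>0"
    have cl: "closed \<Theta>\<^sub>0" "bdd_below \<Theta>\<^sub>0" "bdd_above \<Theta>\<^sub>0"
      using \<open>compact \<Theta>\<^sub>0\<close> by (auto simp: compact_imp_closed bounded_imp_bdd_below bounded_imp_bdd_above compact_imp_bounded)
    have "l \<in> \<Theta>" "u \<in> \<Theta>"
      using closed_contains_Inf[OF False cl(2,1)] closed_contains_Sup[OF False cl(3,1)] \<open>\<Theta>\<^sub>0 \<subseteq> \<Theta>\<close>
      by (auto simp: l_def u_def)
    have between: "\<theta> \<in> {l..u}" if "\<theta> \<in> \<Theta>\<^sub>0" for \<theta>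
      using that cl by (auto simp: l_def u_def cInf_lower cSup_upper)
    then have "l \<le> u" using False by fastforce
    obtain e1 where e1: "e1 > 0" "cball l e1 \<subseteq> \<Theta>"
      using \<open>open \<Theta>\<close> \<open>l \<in> \<Theta>\<close> by (auto simp: open_contains_cball)
    obtain e2 where e2: "e2 > 0" "cball u e2 \<subseteq> \<Theta>"
      using \<open>open \<Theta>\<close> \<open>u \<in> \<Theta>\<close> by (auto simp: open_contains_cball)
    define \<eta> where "\<eta> = min e1 e2"
    have \<eta>: "\<eta> > 0" using e1 e2 by (simp add: \<eta>_def)
    have "l - \<eta> \<in> \<Theta>" using e1 \<eta> by (auto simp: \<eta>_def dist_real_def intro!: subsetD[OF e1(2)])
    moreover have "u + \<eta> \<in> \<Theta>" using e2 \<eta> by (auto simp: \<eta>_def dist_real_def intro!: subsetD[OF e2(2)])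
    ultimately obtain C where C: "C \<ge> 1"
      and fam: "\<And>\<theta>. \<theta> \<in> {l..u} \<Longrightarrow> exp_moment_le \<eta> C (exp_family \<mu> \<theta>)"
        "\<And>\<theta> \<theta>'. \<theta> \<in> {l..u} \<Longrightarrow> \<theta>' \<in> {l..u} \<Longrightarrow> exp_family \<mu> \<theta>' = exp_tilt (exp_family \<mu> \<theta>) (\<theta>' - \<theta>)"
        "\<And>\<theta> \<theta>'. \<theta> \<in> {l..u} \<Longrightarrow> \<theta>' \<in> {l..u} \<Longrightarrow> 1 \<le> C * (LINT x|exp_family \<mu> \<theta>. exp ((\<theta>' - \<theta>) * x))"
      using exp_family_on_interval[OF assms(1) prob_space_exp_family_imp(2)[OF assms(1) assms(3)] \<eta> \<open>l \<le> u\<close>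
          prob_space_exp_family_imp(1)[OF assms(1) assms(3)] prob_space_exp_family_imp(1)[OF assms(1) assms(3)]]
        \<open>l \<in> \<Theta>\<close> by metis
    show ?thesis
      using exponential_tilts_close_to_iid[OF \<eta> C \<open>\<delta> > 0\<close> \<gamma>, of "u - l"] eventually_ge_at_top[of 1]
    proof eventually_elim
      case (elim n)
      show ?case
      proof (intro allI impI; elim conjE)
        fix m T
        assume T: "T \<in> invariant_test_functions n"
          and dist: "L2_set (\<lambda>i. m i - vec_mean n m) {..<n} \<le> \<delta>" and m: "\<forall>i<n. m i \<in> \<Theta>\<^sub>0"
        define \<theta> where "\<theta> = vec_mean n m"
        define d where "d i = m i - \<theta>" for i
        have n: "real n > 0" using elim by simp
        have m_in: "m i \<in> {l..u}" if "i < n" for i using m that between by blast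
        have \<theta>: "\<theta> \<in> {l..u}"
        proof -
          have "real n * l \<le> (\<Sum>i<n. m i)" "(\<Sum>i<n. m i) \<le> real n * u"
            using sum_mono[of "{..<n}" "\<lambda>_. l" m] sum_mono[of "{..<n}" m "\<lambda>_. u"] m_in by auto
          then show ?thesis using n by (simp add: \<theta>_def vec_mean_def field_simps)
        qed
        have d0: "(\<Sum>i<n. d i) = 0"
          using n by (simp add: d_def sum_subtractf \<theta>_def vec_mean_def)
        have d2: "(\<Sum>i<n. (d i)\<^sup>2) \<le> \<delta>\<^sup>2"
          using dist \<open>\<delta> > 0\<close> by (simp add: L2_set_def d_def \<theta>_def real_sqrt_le_iff' sqrt_le_D)
        have tilts: "\<forall>i<n. \<bar>d i\<bar> \<le> u - l \<and> 1 \<le> C * (LINT x|exp_family \<mu> \<theta>. exp (d i * x)) \<and>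
            exp_moment_le \<eta> C (exp_tilt (exp_family \<mu> \<theta>) (d i))"
        proof (intro allI impI)
          fix i assume "i < n"
          from m_in[OF this] \<theta> fam(1)[of "m i"] fam(2,3)[OF \<theta>, of "m i"]
          show "\<bar>d i\<bar> \<le> u - l \<and> 1 \<le> C * (LINT x|exp_family \<mu> \<theta>. exp (d i * x)) \<and>
            exp_moment_le \<eta> C (exp_tilt (exp_family \<mu> \<theta>) (d i))"
            by (auto simp: d_def abs_le_iff)
        qed
        have law: "joint_law \<mu> n m = (\<Pi>\<^sub>M i\<in>{..<n}. exp_tilt (exp_family \<mu> \<theta>) (d i))"
          unfolding joint_law_def d_def using m_in fam(2)[OF \<theta>] by (intro PiM_cong) auto
        have law_mean: "joint_law \<mu> n (\<lambda>_. vec_mean n m) = (\<Pi>\<^sub>M i\<in>{..<n}. exp_family \<mu> \<theta>)"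
          by (simp add: joint_law_def \<theta>_def)
        show "\<bar>(LINT x|joint_law \<mu> n m. T x) - (LINT x|joint_law \<mu> n (\<lambda>_. vec_mean n m). T x)\<bar> \<le> \<gamma>"
          unfolding law law_mean
          using elim(1)[THEN spec, THEN spec, THEN bspec, OF T, THEN mp, OF fam(1)[OF \<theta>],
              THEN mp, OF d0, THEN mp, OF d2, THEN mp, OF tilts] .
      qed
    qed
  qed
  show ?thesis
  proof (rule order_tendstoI)
    fix a :: ennreal assume "0 < a"
    then obtain y where y: "0 < y" "y < a" using dense by blast
    then obtain \<gamma> where \<gamma>: "y = ennreal \<gamma>" "\<gamma> > 0"
      by (cases y) (auto simp: top.extremum_strict)
    show "\<forall>\<^sub>F n in sequentially. ?S n < a"
      using bound[OF \<gamma>(2)]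
    proof eventually_elim
      case (elim n)
      have "?S n \<le> y"
        unfolding \<gamma>(1) using elim by (intro SUP_least) (auto intro!: ennreal_leI)
      with y(2) show ?case by (rule le_less_trans[rotated])
    qed
  qed simp
qed

end
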